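(* Let $q$ be a fixed prime power, let $t$ be a fixed positive integer, and let $\theta$ be a fixed real number. Then $$\lim_{n\to\infty} f(n,t,\sigma_{\theta,n})=\begin{cases} q^{-(1-\theta)t} & \text{if $0<\theta<\frac{1}{2}$,}\\ 1 & \text{if $\frac{1}{2}<\theta<1$,}\end{cases}$$ where $\sigma_{\theta,n}:=q^{-(1-\theta)n}$.
   Context: $\mathbb{F}_q$ is the field with $q$ elements and $\Omega_n$ is the set of all subspaces of the $n$-dimensional vector space $\mathbb{F}_q^n$. For a real number $\sigma>0$ and $0\leqslant k\leqslant n$, put $$\phi_{\sigma,n}(k):=\frac{\sigma^{k}q^{\binom{k}{2}}}{(-\sigma;q)_n},\qquad (-\sigma;q)_n:=\prod_{j=0}^{n-1}(1+\sigma q^j).$$ The $\sigma$-biased (probability) measure $\mu_\sigma$ on $\Omega_n$ is defined by $\mu_{\sigma}(U):=\sum_{x\in U}\phi_{\sigma,n}(\dim x)$ for $U\subset\Omega_n$. A family $U\subset \Omega_n$ is called $t$-intersecting if $\dim(x\cap y)\geqslant t$ for all $x,y\in U$ (including $x=y$). Define $$f(n,t,\sigma):=\max\{\mu_{\sigma}(U)^{\frac{1}{n}}: U\subset\Omega_n \text{ is $t$-intersecting}\}.$$ *)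

theory Defs
  imports
    Complex_Main
    "HOL-Library.Cardinality"
    "HOL-Library.Function_Algebras"
    "HOL-Number_Theory.Prime_Powers"
begin

(* The ambient dimension n varies inside the limit, so the spaces F^n for all n are realised
   inside the space of all sequences over a finite field 'a: F^n consists of the
   sequences vanishing from index n on. The number q of field elements is CARD('a). *)

definition fscale :: "'a::field \<Rightarrow> (nat \<Rightarrow> 'a) \<Rightarrow> (nat \<Rightarrow> 'a)" where
  "fscale c v = (\<lambda>i. c * v i)"

interpretation fvec: vector_space "fscale :: 'a::field \<Rightarrow> (nat \<Rightarrow> 'a) \<Rightarrow> (nat \<Rightarrow> 'a)"
  by unfold_locales (simp_all add: fscale_def fun_eq_iff algebra_simps)

definition Fn :: "nat \<Rightarrow> (nat \<Rightarrow> 'a::field) set" where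
  "Fn n = {v. \<forall>i\<ge>n. v i = 0}"

definition Omega :: "nat \<Rightarrow> (nat \<Rightarrow> 'a::field) set set" where
  "Omega n = {x. fvec.subspace x \<and> x \<subseteq> Fn n}"

definition phi :: "nat \<Rightarrow> real \<Rightarrow> nat \<Rightarrow> nat \<Rightarrow> real" where
  "phi q \<sigma> n k = \<sigma> ^ k * real q ^ (k choose 2) / (\<Prod>j<n. 1 + \<sigma> * real q ^ j)"

definition mu :: "real \<Rightarrow> nat \<Rightarrow> (nat \<Rightarrow> 'a::{field,finite}) set set \<Rightarrow> real" where
  "mu \<sigma> n U = (\<Sum>x\<in>U. phi CARD('a) \<sigma> n (fvec.dim x))"

definition t_intersecting :: "nat \<Rightarrow> (nat \<Rightarrow> 'a::field) set set \<Rightarrow> bool" where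
  "t_intersecting t U \<longleftrightarrow> (\<forall>x\<in>U. \<forall>y\<in>U. t \<le> fvec.dim (x \<inter> y))"

definition fmax :: "'a::{field,finite} itself \<Rightarrow> nat \<Rightarrow> nat \<Rightarrow> real \<Rightarrow> real" where
  "fmax _ n t \<sigma> = Max {mu \<sigma> n U powr (1 / real n) | U :: (nat \<Rightarrow> 'a) set set.
     U \<subseteq> Omega n \<and> t_intersecting t U}"

lemma finite_Fn: "finite (Fn n :: (nat \<Rightarrow> 'a::{field,finite}) set)"
proof -
  have "finite {f :: nat \<Rightarrow> 'a. \<forall>i. (i \<in> {..<n} \<longrightarrow> f i \<in> UNIV) \<and> (i \<notin> {..<n} \<longrightarrow> f i = 0)}"
    by (rule finite_set_of_finite_funs) simp_all
  then show ?thesis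
    by (simp add: Fn_def not_less)
qed

lemma finite_Omega: "finite (Omega n :: (nat \<Rightarrow> 'a::{field,finite}) set set)"
  by (rule finite_subset[of _ "Pow (Fn n)"]) (auto simp: Omega_def finite_Fn)

(* The maximum in fmax ranges over a finite nonempty set; Max is unspecified otherwise. *)
lemma fmax_set:
  "finite {mu \<sigma> n U powr (1 / real n) | U :: (nat \<Rightarrow> 'a::{field,finite}) set set.
     U \<subseteq> Omega n \<and> t_intersecting t U}" (is "finite ?S")
  "{mu \<sigma> n U powr (1 / real n) | U :: (nat \<Rightarrow> 'a::{field,finite}) set set.
     U \<subseteq> Omega n \<and> t_intersecting t U} \<noteq> {}"
proof -
  have "?S \<subseteq> (\<lambda>U :: (nat \<Rightarrow> 'a) set set. mu \<sigma> n U powr (1 / real n)) ` Pow (Omega n)"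
    by auto
  then show "finite ?S"
    by (rule finite_subset) (simp add: finite_Omega)
  have "mu \<sigma> n ({} :: (nat \<Rightarrow> 'a) set set) powr (1 / real n) \<in> ?S"
    by (auto simp: t_intersecting_def intro!: exI[of _ "{}"])
  then show "?S \<noteq> {}" by blast
qed

definition sigma_theta :: "nat \<Rightarrow> real \<Rightarrow> nat \<Rightarrow> real" where
  "sigma_theta q \<theta> n = real q powr (- (1 - \<theta>) * real n)"

end

theory Submission
  imports Defs "HOL-Algebra.Algebraic_Closure_Type" "HOL-Combinatorics.Permutations"
begin

text \<open>Write \<open>q\<close> for the size of the field, \<open>\<sigma> = q powr (- (1 - \<theta>) * n)\<close> and
\<open>Q = \<sigma> q^n = q powr (\<theta> n)\<close>. The measure enters only through moments: a subspace \<open>x\<close>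
drawn from the biased measure has \<open>E (z ^ dim x) = (\<Prod>j<n. 1 + z \<sigma> q^j) / (\<Prod>j<n. 1 + \<sigma> q^j)\<close> by the
q-binomial theorem (\<open>subspace_generating_function\<close>), and for \<open>z = q^s\<close> the quotient telescopes to
\<open>s\<close> factors, so that \<open>E (q ^ (s * dim x))\<close> is \<open>Q^s\<close> up to a factor that does not depend on \<open>n\<close>. Such
factors disappear in the \<open>n\<close>-th root.

Suppose \<open>\<theta> < 1/2\<close>. The subspaces containing a fixed \<open>t\<close>-dimensional space form a \<open>t\<close>-intersecting family,
and the same generating function, restricted to them, gives it measure about \<open>\<sigma>^t = q powr (- (1 - \<theta>) t n)\<close>
(\<open>mu_over_Fn_ge\<close>). For the upper bound let \<open>U\<close> be \<open>t\<close>-intersecting. If \<open>2 k \<le> n\<close>, then at most a fraction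
\<open>q^(- t (n - k))\<close> of all \<open>k\<close>-dimensional subspaces lies in \<open>U\<close> (\<open>card_t_intersecting_layer\<close>). The reason is
a coding one: there is a family of \<open>q^(t (n - k))\<close> subspaces of dimension \<open>k\<close> that pairwise meet in dimension less than \<open>t\<close>
(a lifted Gabidulin code), \<open>U\<close> contains at most one of them, and likewise at most one of their images under
any linear automorphism; averaging over all automorphisms turns this into the bound on the density of \<open>U\<close>.
Summing over \<open>k\<close>, the part of \<open>U\<close> in dimensions at most \<open>n/2\<close> has measure at most
\<open>q^(- t n) E (q ^ (t * dim x))\<close>, which is of order \<open>q^(- t n) Q^t = q powr (- (1 - \<theta>) t n)\<close>. The dimensions above
\<open>n/2\<close> have measure at most \<open>q powr (- s n / 2) E (q ^ (s * dim x))\<close>, of order \<open>q powr (- s (1/2 - \<theta>) n)\<close>, by Markov's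
inequality, which is as small as needed once \<open>s\<close> is large (\<open>mu_t_intersecting_le\<close>).

Suppose \<open>\<theta> > 1/2\<close>. All measures are at most \<open>1\<close>. Subspaces of dimension at least \<open>(n + t)/2\<close> pairwise meet in
dimension at least \<open>t\<close>, and Markov's inequality for \<open>E (q ^ (- dim x))\<close>, which is of order \<open>1/Q\<close>, shows that their
total measure tends to \<open>1\<close> (\<open>mu_large_dim_ge\<close>).\<close>

section \<open>Subspaces over a finite field\<close>

lemma (in vector_space) card_span_independent:
  assumes fin: "finite (UNIV :: 'a set)" and "finite B" "independent B"
  shows "finite (span B) \<and> card (span B) = CARD('a) ^ card B"
  using assms(2,3)
proof (induction B rule: finite_induct)
  case (insert b B)
  have b: "b \<notin> span B" and B: "independent B"
    using insert.prems insert.hyps(2) by (simp_all add: independent_insert)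
  let ?f = "\<lambda>(c, u). scale c b + u"
  have span: "span (insert b B) = ?f ` (UNIV \<times> span B)"
  proof (intro Set.set_eqI iffI)
    fix x assume "x \<in> span (insert b B)"
    then obtain c where "x - scale c b \<in> span B" by (auto simp: span_insert)
    then show "x \<in> ?f ` (UNIV \<times> span B)"
      by (intro image_eqI[of _ _ "(c, x - scale c b)"]) auto
  next
    fix x assume "x \<in> ?f ` (UNIV \<times> span B)"
    then obtain c u where "x = scale c b + u" "u \<in> span B" by auto
    then show "x \<in> span (insert b B)" unfolding span_insert by (auto intro!: exI[of _ c])
  qed
  have inj: "inj_on ?f (UNIV \<times> span B)"
  proof (intro inj_onI, clarsimp)
    fix c u c' u' assume uu: "u \<in> span B" "u' \<in> span B" and eq: "scale c b + u = scale c' b + u'"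
    have "scale (c - c') b = u' - u" using eq by (simp add: scale_left_diff_distrib algebra_simps)
    then have "scale (c - c') b \<in> span B" using uu by (simp add: span_diff)
    then have "scale (inverse (c - c') * (c - c')) b \<in> span B"
      using span_scale[of "scale (c - c') b" B "inverse (c - c')"] by simp
    then have "c = c'" using b by (cases "c = c'") auto
    then show "c = c' \<and> u = u'" using eq by simp
  qed
  show ?case
    using fin insert.IH[OF B] insert.hyps by (simp add: span card_image[OF inj] card_cartesian_product)
qed auto

lemma (in vector_space) card_subspace:
  assumes "finite (UNIV :: 'a set)" "subspace V" "finite V"
  shows "card V = CARD('a) ^ dim V"
proof -
  obtain B where B: "B \<subseteq> V" "independent B" "V \<subseteq> span B" "card B = dim V"
    using basis_exists by blast
  then have "span B = V" using assms(2) span_minimal by blast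
  then show ?thesis using card_span_independent[OF assms(1) _ B(2)] B assms(3) finite_subset by auto
qed

lemma CARD_field_ge_2: "2 \<le> CARD('a::{field,finite})"
proof -
  have "card {0, 1 :: 'a} \<le> CARD('a)" by (intro card_mono) auto
  then show ?thesis by simp
qed

lemma Fn_add [simp]: "u \<in> Fn n \<Longrightarrow> v \<in> Fn n \<Longrightarrow> u + v \<in> Fn n"
  and Fn_scale [simp]: "u \<in> Fn n \<Longrightarrow> fscale c u \<in> Fn n"
  and Fn_zero [simp]: "0 \<in> Fn n"
  and Fn_diff [simp]: "u \<in> Fn n \<Longrightarrow> v \<in> Fn n \<Longrightarrow> u - v \<in> Fn n"
  by (auto simp: Fn_def fscale_def)

lemma subspace_Fn: "fvec.subspace (Fn n)"
  by (simp add: fvec.subspace_def)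

lemma Fn_mono: "m \<le> n \<Longrightarrow> Fn m \<subseteq> Fn n"
  by (auto simp: Fn_def)

lemma mem_Fn_Suc: "v \<in> Fn n \<longleftrightarrow> v \<in> Fn (Suc n) \<and> v n = 0"
  by (auto simp: Fn_def le_less Suc_le_eq) (metis Suc_lessI)

text \<open>The vectors of \<open>x\<close> with last coordinate \<open>1\<close> form a coset of \<open>x \<inter> Fn n\<close>.\<close>

lemma card_slice:
  assumes x: "fvec.subspace x" and v0: "v0 \<in> x" "v0 n = (1 :: 'a::field)" and sub: "x \<subseteq> Fn (Suc n)"
  shows "card {v \<in> x. v n = 1} = card (x \<inter> Fn n)"
proof (rule bij_betw_same_card[of "\<lambda>v. v - v0"], rule bij_betw_byWitness[of _ "\<lambda>u. u + v0"])
  have "u \<in> Fn n" if "u \<in> x" "u n = 0" for u using that sub by (auto simp: mem_Fn_Suc[of u n])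
  then show "(\<lambda>v. v - v0) ` {v \<in> x. v n = 1} \<subseteq> x \<inter> Fn n"
    using v0 x by (auto simp: fvec.subspace_diff)
qed (use v0 x in \<open>auto simp: Fn_def fvec.subspace_add\<close>)

lemma card_Fn: "card (Fn n :: (nat \<Rightarrow> 'a::{field,finite}) set) = CARD('a) ^ n"
proof -
  have "bij_betw (\<lambda>f i. if i < n then f i else 0) ({..<n} \<rightarrow>\<^sub>E UNIV) (Fn n :: (nat \<Rightarrow> 'a) set)"
    by (rule bij_betw_byWitness[of _ "\<lambda>v. restrict v {..<n}"])
       (auto simp: Fn_def fun_eq_iff PiE_def extensional_def)
  then show ?thesis
    by (auto dest!: bij_betw_same_card simp: card_PiE)
qed

lemma dim_Fn: "fvec.dim (Fn n :: (nat \<Rightarrow> 'a::{field,finite}) set) = n"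
proof -
  have "CARD('a) ^ fvec.dim (Fn n :: (nat \<Rightarrow> 'a) set) = CARD('a) ^ n"
    using fvec.card_subspace[OF finite_class.finite_UNIV subspace_Fn finite_Fn[where 'a='a], of n] by (simp add: card_Fn)
  then show ?thesis using CARD_field_ge_2[where 'a='a] by (subst (asm) power_inject_exp) auto
qed

lemma OmegaD:
  assumes "x \<in> Omega n"
  shows "fvec.subspace x" "x \<subseteq> Fn n"
  using assms by (auto simp: Omega_def)

lemma finite_in_Omega: "(x :: (nat \<Rightarrow> 'a::{field,finite}) set) \<in> Omega n \<Longrightarrow> finite x"
  using OmegaD(2) finite_Fn finite_subset by blast

lemma card_in_Omega: "(x :: (nat \<Rightarrow> 'a::{field,finite}) set) \<in> Omega n \<Longrightarrow> card x = CARD('a) ^ fvec.dim x"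
  by (rule fvec.card_subspace) (auto simp: OmegaD intro: finite_in_Omega)

lemma Omega_Int: "x \<in> Omega n \<Longrightarrow> y \<in> Omega n \<Longrightarrow> x \<inter> y \<in> Omega n"
  by (auto simp: Omega_def fvec.subspace_inter)

lemma card_le_iff_dim_le:
  fixes x y :: "(nat \<Rightarrow> 'a::{field,finite}) set"
  assumes "x \<in> Omega n" "y \<in> Omega m"
  shows "card x \<le> card y \<longleftrightarrow> fvec.dim x \<le> fvec.dim y"
  using CARD_field_ge_2[where 'a='a] by (simp add: card_in_Omega[OF assms(1)] card_in_Omega[OF assms(2)])

lemma dim_le_Omega: "(x :: (nat \<Rightarrow> 'a::{field,finite}) set) \<in> Omega n \<Longrightarrow> fvec.dim x \<le> n"
  using card_le_iff_dim_le[of x n "Fn n" n] subspace_Fn card_mono[OF finite_Fn, of x n]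
  by (auto simp: Omega_def dim_Fn)

section \<open>The generating function of subspaces by dimension\<close>

definition adjoin :: "(nat \<Rightarrow> 'a::field) \<Rightarrow> (nat \<Rightarrow> 'a) set \<Rightarrow> (nat \<Rightarrow> 'a) set" where
  "adjoin v y = {u + fscale c v | u c. u \<in> y}"

lemma adjoin_Int_Fn:
  assumes "y \<subseteq> Fn n" "v n = 1"
  shows "adjoin v y \<inter> Fn n = y"
proof (intro Set.set_eqI iffI)
  fix w assume "w \<in> adjoin v y \<inter> Fn n"
  then obtain u c where w: "w = u + fscale c v" "u \<in> y" "w n = 0" by (auto simp: adjoin_def Fn_def)
  then have "c = 0" using assms by (auto simp: Fn_def fscale_def)
  then show "w \<in> y" using w by simp
next
  fix w assume w: "w \<in> y"
  have "w \<in> adjoin v y"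
    unfolding adjoin_def mem_Collect_eq using w by (intro exI[of _ w] exI[of _ "0::'a"]) simp
  then show "w \<in> adjoin v y \<inter> Fn n" using w assms(1) by blast
qed

lemma adjoin_Omega:
  assumes y: "y \<in> Omega n" and v: "v \<in> Fn (Suc n)"
  shows "adjoin v y \<in> Omega (Suc n)"
proof -
  have sub: "fvec.subspace y" using y by (simp add: OmegaD)
  have "fvec.subspace (adjoin v y)"
    unfolding fvec.subspace_def
  proof (intro conjI ballI allI)
    show "0 \<in> adjoin v y"
      unfolding adjoin_def mem_Collect_eq using fvec.subspace_0[OF sub]
      by (intro exI[of _ 0] exI[of _ "0::'a"]) auto
  next
    fix a b assume "a \<in> adjoin v y" "b \<in> adjoin v y"
    then obtain u c u' c' where "a = u + fscale c v" "u \<in> y" "b = u' + fscale c' v" "u' \<in> y"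
      by (auto simp: adjoin_def)
    then show "a + b \<in> adjoin v y"
      unfolding adjoin_def mem_Collect_eq using fvec.subspace_add[OF sub]
      by (intro exI[of _ "u + u'"] exI[of _ "c + c'"]) (auto simp: fvec.scale_left_distrib)
  next
    fix d a assume "a \<in> adjoin v y"
    then obtain u c where "a = u + fscale c v" "u \<in> y" by (auto simp: adjoin_def)
    then show "fscale d a \<in> adjoin v y"
      unfolding adjoin_def mem_Collect_eq using fvec.subspace_scale[OF sub]
      by (intro exI[of _ "fscale d u"] exI[of _ "d * c"]) (auto simp: fvec.scale_right_distrib)
  qed
  moreover have "adjoin v y \<subseteq> Fn (Suc n)"
    using v OmegaD(2)[OF y] Fn_mono[of n "Suc n"] by (auto simp: adjoin_def)
  ultimately show ?thesis by (simp add: Omega_def)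
qed

lemma mem_adjoin: "fvec.subspace y \<Longrightarrow> v \<in> adjoin v y"
  unfolding adjoin_def mem_Collect_eq
  by (intro exI[of _ 0] exI[of _ "1::'a"]) (auto simp: fvec.subspace_0)

lemma adjoin_slice:
  assumes x: "x \<in> Omega (Suc n)" and v: "v \<in> x" "v n = 1"
  shows "adjoin v (x \<inter> Fn n) = x"
proof (intro Set.set_eqI iffI)
  fix w assume "w \<in> adjoin v (x \<inter> Fn n)"
  then show "w \<in> x"
    using v OmegaD(1)[OF x] by (auto simp: adjoin_def fvec.subspace_add fvec.subspace_scale)
next
  fix w assume w: "w \<in> x"
  let ?u = "w - fscale (w n) v"
  have "?u \<in> x" using w v OmegaD(1)[OF x] by (auto simp: fvec.subspace_diff fvec.subspace_scale)
  moreover have "?u n = 0" using v by (simp add: fscale_def)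
  moreover have "?u \<in> Fn (Suc n)" using \<open>?u \<in> x\<close> OmegaD(2)[OF x] by blast
  ultimately have "?u \<in> x \<inter> Fn n" using mem_Fn_Suc by blast
  then show "w \<in> adjoin v (x \<inter> Fn n)"
    unfolding adjoin_def mem_Collect_eq by (intro exI[of _ ?u] exI[of _ "w n"]) simp
qed

lemma dim_adjoin:
  fixes y :: "(nat \<Rightarrow> 'a::{field,finite}) set"
  assumes y: "y \<in> Omega n" and v: "v \<in> Fn (Suc n)" "v n = 1"
  shows "fvec.dim (adjoin v y) = Suc (fvec.dim y)"
proof -
  have "bij_betw (\<lambda>(u, c). u + fscale c v) (y \<times> UNIV) (adjoin v y)"
  proof (rule bij_betw_imageI)
    show "inj_on (\<lambda>(u, c). u + fscale c v) (y \<times> UNIV)"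
    proof (intro inj_onI, clarsimp)
      fix u c u' c' assume "u \<in> y" "u' \<in> y" and eq: "u + fscale c v = u' + fscale c' v"
      then have "u n = 0" "u' n = 0" using OmegaD(2)[OF y] by (auto simp: Fn_def)
      then have "c = c'" using fun_cong[OF eq, of n] v(2) by (simp add: fscale_def)
      then show "u = u' \<and> c = c'" using eq by simp
    qed
  qed (auto simp: adjoin_def)
  then have "card (adjoin v y) = card y * CARD('a)"
    by (auto dest!: bij_betw_same_card simp: card_cartesian_product)
  then have "CARD('a) ^ fvec.dim (adjoin v y) = CARD('a) ^ Suc (fvec.dim y)"
    using card_in_Omega[OF y] card_in_Omega[OF adjoin_Omega[OF y v(1)]] by simp
  then show ?thesis using CARD_field_ge_2[where 'a='a] by (subst (asm) power_inject_exp) auto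
qed

text \<open>A subspace of \<open>Fn (Suc n)\<close> that is not contained in \<open>Fn n\<close> is \<open>adjoin v y\<close>, where \<open>y\<close> is its intersection
with \<open>Fn n\<close> and \<open>v\<close> is any of its vectors with last coordinate \<open>1\<close>. For given \<open>y\<close> there are \<open>q^n\<close> choices of
\<open>v\<close>, and \<open>q ^ dim y\<close> of them give the same subspace. Hence \<open>y\<close> is extended in \<open>q^n / q ^ dim y\<close> ways.\<close>

lemma sum_Omega_Suc:
  fixes h :: "nat \<Rightarrow> real"
  assumes "t \<le> n"
  shows "(\<Sum>x | x \<in> Omega (Suc n) \<and> Fn t \<subseteq> x. h (fvec.dim (x :: (nat \<Rightarrow> 'a::{field,finite}) set))) =
    (\<Sum>y | y \<in> Omega n \<and> Fn t \<subseteq> y. h (fvec.dim (y :: (nat \<Rightarrow> 'a) set)) +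
       real CARD('a) ^ n / real CARD('a) ^ fvec.dim y * h (Suc (fvec.dim y)))"
proof -
  let ?q = "real CARD('a)"
  define S where "S x = {v \<in> x. v n = (1 :: 'a)}" for x
  define R where "R = {y \<in> Omega n. (Fn t :: (nat \<Rightarrow> 'a) set) \<subseteq> y}"
  define N where "N = {x \<in> Omega (Suc n). Fn t \<subseteq> x \<and> \<not> x \<subseteq> (Fn n :: (nat \<Rightarrow> 'a) set)}"
  have q0: "?q \<noteq> 0" by simp
  have sliceN: "\<exists>v. v \<in> S x" if x: "x \<in> N" for x
  proof -
    obtain w where w: "w \<in> x" "w \<notin> Fn n" using x by (auto simp: N_def)
    moreover have "w \<in> Fn (Suc n)" using w x OmegaD(2) by (auto simp: N_def)
    ultimately have wn: "w n \<noteq> 0" using mem_Fn_Suc by blast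
    have "fscale (inverse (w n)) w \<in> x"
      using w(1) x OmegaD(1)[of x "Suc n"] by (simp add: N_def fvec.subspace_scale)
    then have "fscale (inverse (w n)) w \<in> S x" using wn by (simp add: S_def fscale_def)
    then show ?thesis by blast
  qed
  have dimN: "fvec.dim x = Suc (fvec.dim (x \<inter> Fn n))" "card (S x) = card (x \<inter> Fn n)"
    "x \<inter> Fn n \<in> R" if x: "x \<in> N" for x
  proof -
    have xO: "x \<in> Omega (Suc n)" using x by (simp add: N_def)
    obtain v where v: "v \<in> x" "v n = 1" using sliceN[OF x] by (auto simp: S_def)
    have I: "x \<inter> Fn n \<in> Omega n"
      using OmegaD(1)[OF xO] by (auto simp: Omega_def fvec.subspace_inter subspace_Fn)
    then show "x \<inter> Fn n \<in> R" using x Fn_mono[OF assms] by (auto simp: R_def N_def)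
    show "fvec.dim x = Suc (fvec.dim (x \<inter> Fn n))"
      using dim_adjoin[OF I, of v] adjoin_slice[OF xO v] v OmegaD(2)[OF xO] by auto
    show "card (S x) = card (x \<inter> Fn n)"
      unfolding S_def by (rule card_slice[OF OmegaD(1)[OF xO] v OmegaD(2)[OF xO]])
  qed
  have cardS: "real (card (S (Fn (Suc n) :: (nat \<Rightarrow> 'a) set))) = ?q ^ n"
  proof -
    have "card (S (Fn (Suc n) :: (nat \<Rightarrow> 'a) set)) = card (Fn (Suc n) \<inter> Fn n :: (nat \<Rightarrow> 'a) set)"
      unfolding S_def
      by (rule card_slice[of _ "\<lambda>i. if i = n then 1 else 0"]) (simp_all add: subspace_Fn, simp add: Fn_def)
    also have "Fn (Suc n) \<inter> Fn n = (Fn n :: (nat \<Rightarrow> 'a) set)" using Fn_mono[of n "Suc n"] by auto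
    finally show ?thesis by (simp add: card_Fn)
  qed
  have RO: "y \<in> Omega n" if "y \<in> R" for y using that by (simp add: R_def)
  have finR: "finite R" by (rule finite_subset[OF _ finite_Omega[of n]]) (auto simp: R_def)
  have finN: "finite N" by (rule finite_subset[OF _ finite_Omega[of "Suc n"]]) (auto simp: N_def)
  have finS: "finite (S x)" if "x \<in> N" for x
    using that finite_in_Omega[of x "Suc n"] by (simp add: S_def N_def)
  \<comment> \<open>Each new subspace is counted once for every vector of its slice, with weight one over the size of the slice.\<close>
  have "(\<Sum>x\<in>N. h (fvec.dim x)) = (\<Sum>x\<in>N. \<Sum>v\<in>S x. h (fvec.dim x) / ?q ^ fvec.dim (x \<inter> Fn n))"
    by (rule sum.cong) (simp_all add: dimN(2) card_in_Omega[OF RO[OF dimN(3)]])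
  also have "\<dots> = (\<Sum>(x, v)\<in>Sigma N S. h (fvec.dim x) / ?q ^ fvec.dim (x \<inter> Fn n))"
    by (rule sum.Sigma) (auto simp: finN finS)
  also have "\<dots> = (\<Sum>(y, v)\<in>R \<times> S (Fn (Suc n)). h (Suc (fvec.dim (y :: (nat \<Rightarrow> 'a) set))) / ?q ^ fvec.dim y)"
  proof (rule sum.reindex_bij_witness[of _ "\<lambda>(y, v). (adjoin v y, v)" "\<lambda>(x, v). (x \<inter> Fn n, v)"])
    fix a assume "a \<in> Sigma N S"
    then obtain x v where a: "a = (x, v)" "x \<in> N" "v \<in> x" "v n = 1" by (auto simp: S_def)
    then show "(case case a of (x, v) \<Rightarrow> (x \<inter> Fn n, v) of (y, v) \<Rightarrow> (adjoin v y, v)) = a"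
      using adjoin_slice by (auto simp: N_def)
    show "(case a of (x, v) \<Rightarrow> (x \<inter> Fn n, v)) \<in> R \<times> S (Fn (Suc n))"
      using a dimN(3) OmegaD(2) by (auto simp: N_def S_def)
    show "(case case a of (x, v) \<Rightarrow> (x \<inter> Fn n, v) of (y, v) \<Rightarrow> h (Suc (fvec.dim y)) / ?q ^ fvec.dim y)
        = (case a of (x, v) \<Rightarrow> h (fvec.dim x) / ?q ^ fvec.dim (x \<inter> Fn n))"
      using a dimN(1) by auto
  next
    fix b :: "(nat \<Rightarrow> 'a) set \<times> (nat \<Rightarrow> 'a)" assume "b \<in> R \<times> S (Fn (Suc n))"
    then obtain y v where b: "b = (y, v)" "y \<in> Omega n" "v \<in> Fn (Suc n)" "v n = 1" "y \<in> R"
      by (auto simp: S_def R_def)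
    have I: "adjoin v y \<inter> Fn n = y" using adjoin_Int_Fn[of y n v] OmegaD(2)[OF b(2)] b(4) by simp
    then show "(case case b of (y, v) \<Rightarrow> (adjoin v y, v) of (x, v) \<Rightarrow> (x \<inter> Fn n, v)) = b"
      using b by auto
    have "v \<in> adjoin v y" "v \<notin> Fn n" using mem_adjoin OmegaD(1) b by (auto simp: Fn_def)
    moreover have "Fn t \<subseteq> adjoin v y" using I b(5) by (auto simp: R_def)
    ultimately have "adjoin v y \<in> N" using adjoin_Omega[OF b(2,3)] by (auto simp: N_def)
    then show "(case b of (y, v) \<Rightarrow> (adjoin v y, v)) \<in> Sigma N S"
      using b \<open>v \<in> adjoin v y\<close> by (auto simp: S_def)
  qed
  also have "\<dots> = (\<Sum>y\<in>R. \<Sum>v\<in>S (Fn (Suc n)). h (Suc (fvec.dim (y :: (nat \<Rightarrow> 'a) set))) / ?q ^ fvec.dim y)"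
    by (intro sum.Sigma[symmetric]) (auto simp: finR finite_Fn S_def)
  also have "\<dots> = (\<Sum>y\<in>R. ?q ^ n / ?q ^ fvec.dim (y :: (nat \<Rightarrow> 'a) set) * h (Suc (fvec.dim y)))"
    by (simp add: cardS)
  finally have *: "(\<Sum>x\<in>N. h (fvec.dim x)) =
    (\<Sum>y\<in>R. ?q ^ n / ?q ^ fvec.dim (y :: (nat \<Rightarrow> 'a) set) * h (Suc (fvec.dim y)))" .
  have split: "{x. x \<in> Omega (Suc n) \<and> Fn t \<subseteq> x} = R \<union> N"
    using Fn_mono[of n "Suc n"] by (auto simp: N_def R_def Omega_def)
  have "(\<Sum>x | x \<in> Omega (Suc n) \<and> Fn t \<subseteq> x. h (fvec.dim (x :: (nat \<Rightarrow> 'a) set))) =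
    (\<Sum>x\<in>R. h (fvec.dim x)) + (\<Sum>x\<in>N. h (fvec.dim x))"
    unfolding split by (rule sum.union_disjoint[OF finR finN]) (auto simp: N_def R_def Omega_def)
  then show ?thesis by (simp add: * sum.distrib R_def)
qed

text \<open>This is the q-binomial theorem, stated for the subspaces above \<open>Fn t\<close>: passing from \<open>n\<close> to \<open>Suc n\<close>
multiplies every term by the same factor \<open>1 + z q^n\<close>, because \<open>Suc d choose 2 = d + (d choose 2)\<close> cancels the
denominator \<open>q^d\<close> of the recursion. The case \<open>t = 0\<close> gives the moments of the biased measure, and general \<open>t\<close>
gives the measure of the extremal family.\<close>

theorem subspace_generating_function:
  fixes z :: real
  assumes "t \<le> n"
  shows "(\<Sum>x | x \<in> Omega n \<and> Fn t \<subseteq> x. z ^ fvec.dim (x :: (nat \<Rightarrow> 'a::{field,finite}) set) *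
      real CARD('a) ^ (fvec.dim x choose 2)) =
    z ^ t * real CARD('a) ^ (t choose 2) * (\<Prod>j=t..<n. 1 + z * real CARD('a) ^ j)"
  using assms
proof (induction n rule: dec_induct)
  case base
  have "{x. x \<in> Omega t \<and> Fn t \<subseteq> x} = {Fn t :: (nat \<Rightarrow> 'a) set}"
    by (auto simp: Omega_def subspace_Fn)
  then show ?case by (simp add: dim_Fn)
next
  case (step n)
  let ?q = "real CARD('a)"
  have "z ^ d * ?q ^ (d choose 2) + ?q ^ n / ?q ^ d * (z ^ Suc d * ?q ^ (Suc d choose 2)) =
    (1 + z * ?q ^ n) * (z ^ d * ?q ^ (d choose 2))" for d
  proof -
    have "Suc d choose 2 = d + (d choose 2)" by (simp add: numeral_2_eq_2)
    then have "?q ^ (Suc d choose 2) = ?q ^ d * ?q ^ (d choose 2)" by (simp add: power_add)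
    then show ?thesis by (simp add: field_simps)
  qed
  then show ?case
    using step.hyps
    by (subst sum_Omega_Suc) (simp_all add: sum_distrib_left[symmetric] step.IH mult.commute)
qed

section \<open>Finite subfields of the algebraic closure\<close>

text \<open>Multiplication by \<open>c \<noteq> 0\<close> permutes the nonzero elements, so their product is multiplied by
\<open>c ^ (q - 1) = 1\<close>.\<close>

lemma power_CARD_field: "(c :: 'a::{field,finite}) ^ CARD('a) = c"
proof (cases "c = 0")
  case False
  let ?P = "\<Prod>y\<in>UNIV - {0 :: 'a}. y"
  have "?P = (\<Prod>y\<in>UNIV - {0}. c * y)"
    by (rule prod.reindex_bij_witness[of _ "\<lambda>y. c * y" "\<lambda>y. y / c"]) (use False in auto)
  also have "\<dots> = c ^ (CARD('a) - 1) * ?P"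
    by (simp add: prod.distrib card_Diff_singleton)
  finally have "c ^ (CARD('a) - 1) = 1" by auto
  then have "c * c ^ (CARD('a) - 1) = c" by simp
  then show ?thesis using CARD_field_ge_2[where 'a='a] by (simp flip: power_Suc)
qed simp

lemma power_CARD_power_field: "(c :: 'a::{field,finite}) ^ (CARD('a) ^ i) = c"
  by (induction i) (simp_all add: power_CARD_field power_mult)

lemma CARD_field_eq_CHAR_power:
  assumes "primepow CARD('a::{field,finite})"
  shows "Factorial_Ring.prime CHAR('a)" and "\<exists>e. CARD('a) = CHAR('a) ^ e"
proof -
  show P: "Factorial_Ring.prime CHAR('a)"
    using finite_imp_CHAR_pos[where 'a='a] prime_CHAR_semidom[where 'a='a] by simp
  obtain p e where pe: "Factorial_Ring.prime p" "CARD('a) = p ^ e" using assms by (auto simp: primepow_def)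
  have "of_nat CARD('a) = (0 :: 'a)"
  proof -
    have "(\<Sum>x\<in>UNIV. x + 1 :: 'a) = (\<Sum>x\<in>UNIV. x)"
      by (rule sum.reindex_bij_witness[of _ "\<lambda>x. x - 1" "\<lambda>x. x + 1"]) auto
    then show ?thesis by (simp add: sum.distrib)
  qed
  then have "CHAR('a) dvd p ^ e" by (simp add: of_nat_eq_0_iff_char_dvd flip: pe(2))
  then have "CHAR('a) = p" using P pe(1) prime_dvd_power primes_dvd_imp_eq by blast
  then show "\<exists>e. CARD('a) = CHAR('a) ^ e" using pe by blast
qed

text \<open>The field has \<open>q = p^e\<close> elements with \<open>p\<close> the characteristic, so raising to the power \<open>q^i\<close> is an
iterate of the Frobenius map and hence additive on the algebraic closure.\<close>

lemma frobenius_add: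
  assumes "primepow CARD('a::{field,finite})"
  shows "(x + y :: 'a alg_closure) ^ (CARD('a) ^ i) = x ^ (CARD('a) ^ i) + y ^ (CARD('a) ^ i)"
proof -
  obtain e where "CARD('a) = CHAR('a) ^ e" using CARD_field_eq_CHAR_power(2)[OF assms] by blast
  then have "CARD('a) ^ i = CHAR('a alg_closure) ^ (e * i)" by (simp add: power_mult)
  then show ?thesis
    using CARD_field_eq_CHAR_power(1)[OF assms] by (intro freshmans_dream') auto
qed

lemma frobenius_sum:
  assumes "primepow CARD('a::{field,finite})"
  shows "(\<Sum>j\<in>J. f j :: 'a alg_closure) ^ (CARD('a) ^ i) = (\<Sum>j\<in>J. f j ^ (CARD('a) ^ i))"
  by (induction J rule: infinite_finite_induct) (simp_all add: frobenius_add[OF assms])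

text \<open>Over an algebraically closed field the multiset of roots has \<open>degree p\<close> elements, and a multiple root
would also be a root of the derivative.\<close>

lemma card_roots_separable:
  fixes p :: "'a::alg_closed_field poly"
  assumes "p \<noteq> 0" and sep: "\<And>x. poly p x = 0 \<Longrightarrow> poly (pderiv p) x \<noteq> 0"
  shows "card {x. poly p x = 0} = degree p"
proof -
  define c where "c = lead_coeff p"
  have c0: "c \<noteq> 0" using assms(1) by (simp add: c_def)
  obtain A where A: "size A = degree p" "p = smult c (\<Prod>x\<in>#A. [:-x, 1:])"
    using alg_closed_imp_factorization[OF assms(1)] unfolding c_def by blast
  have ev: "poly (\<Prod>y\<in>#B. [:-y, 1:]) x = (\<Prod>y\<in>#B. x - y)" for B and x :: 'a
    by (induction B) (auto simp: algebra_simps)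
  have root: "poly p x = 0 \<longleftrightarrow> x \<in># A" for x
    unfolding A(2) using c0 by (auto simp: ev)
  have "count A x = 1" if x: "x \<in># A" for x
  proof -
    obtain B where B: "A = add_mset x B" using multi_member_split[OF x] by blast
    let ?r = "smult c (\<Prod>y\<in>#B. [:-y, 1:])"
    have p: "p = [:-x, 1:] * ?r" unfolding A(2) by (simp only: B image_mset_add_mset prod_mset.add_mset mult_smult_right)
    have "poly (pderiv p) x = poly ?r x"
      unfolding p pderiv_mult by (simp add: pderiv_pCons)
    then have "poly ?r x \<noteq> 0" using sep[of x] x root by simp
    then show ?thesis by (auto simp: ev B count_eq_zero_iff)
  qed
  then have "size A = card (set_mset A)" by (simp add: size_multiset_overloaded_eq)
  moreover have "{x. poly p x = 0} = set_mset A" using root by auto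
  ultimately show ?thesis using A(1) by simp
qed

definition ascale :: "'a::field \<Rightarrow> 'a alg_closure \<Rightarrow> 'a alg_closure" where
  "ascale c x = to_ac c * x"

interpretation avec: vector_space "ascale :: 'a::field \<Rightarrow> 'a alg_closure \<Rightarrow> 'a alg_closure"
  by unfold_locales (simp_all add: ascale_def algebra_simps)

definition GFext :: "nat \<Rightarrow> 'a::{field,finite} alg_closure set" where
  "GFext m = {x. x ^ (CARD('a) ^ m) = x}"

text \<open>\<open>GFext m\<close> is the subfield with \<open>q^m\<close> elements: its elements are the roots of \<open>X ^ (q^m) - X\<close>, which is
separable because its derivative is \<open>-1\<close> in characteristic \<open>p\<close>.\<close>

lemma card_GFext:
  assumes pp: "primepow CARD('a::{field,finite})" and m: "0 < m"
  shows "card (GFext m :: 'a alg_closure set) = CARD('a) ^ m"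
proof -
  define N where "N = CARD('a) ^ m"
  have N2: "N \<ge> 2"
    using CARD_field_ge_2[where 'a='a] m power_increasing[of 1 m "CARD('a)"] by (simp add: N_def)
  define p where "p = monom 1 N + [:0, -1 :: 'a alg_closure:]"
  have deg: "degree p = N"
    unfolding p_def using N2 by (subst degree_add_eq_left) (auto simp: degree_monom_eq)
  obtain e where e: "CARD('a) = CHAR('a) ^ e" using CARD_field_eq_CHAR_power(2)[OF pp] by blast
  then have "e \<noteq> 0" using CARD_field_ge_2[where 'a='a] by (intro notI) simp
  then have "0 < e * m" using m by simp
  moreover have "N = CHAR('a) ^ (e * m)" unfolding N_def e by (simp only: power_mult)
  ultimately have "CHAR('a alg_closure) dvd N" using dvd_power[of "e * m" "CHAR('a)"] by simp
  then have N0: "of_nat N = (0 :: 'a alg_closure)" using of_nat_eq_0_iff_char_dvd by blast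
  have "pderiv p = [:-1:]"
    by (simp add: p_def pderiv_add pderiv_monom pderiv_pCons N0)
  then have "card {x. poly p x = 0} = N"
    using card_roots_separable[of p] deg N2 by fastforce
  then show ?thesis by (simp add: p_def poly_monom GFext_def N_def)
qed

lemma finite_GFext:
  assumes "primepow CARD('a::{field,finite})" "0 < m"
  shows "finite (GFext m :: 'a alg_closure set)"
  by (rule card_ge_0_finite) (simp add: card_GFext[OF assms])

lemma subspace_GFext:
  assumes "primepow CARD('a::{field,finite})"
  shows "avec.subspace (GFext m :: 'a alg_closure set)"
  by (auto simp: avec.subspace_def GFext_def frobenius_add[OF assms] ascale_def power_mult_distrib
      power_CARD_power_field power_0_left simp flip: to_ac_power)

section \<open>Linearised polynomials\<close>

text \<open>Linearised polynomials: the monomials have exponents \<open>q^i\<close>, which makes the evaluation map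
linear over the ground field.\<close>

definition linpoly :: "nat \<Rightarrow> (nat \<Rightarrow> 'a::{field,finite} alg_closure) \<Rightarrow> 'a alg_closure \<Rightarrow> 'a alg_closure" where
  "linpoly t a x = (\<Sum>i<t. a i * x ^ (CARD('a) ^ i))"

lemma linear_linpoly:
  assumes "primepow CARD('a::{field,finite})"
  shows "Vector_Spaces.linear ascale ascale (linpoly t (a :: nat \<Rightarrow> 'a alg_closure))"
  unfolding Vector_Spaces.linear_iff
  by (auto simp: avec.vector_space_axioms linpoly_def frobenius_add[OF assms] ascale_def power_mult_distrib
      power_CARD_power_field sum.distrib sum_distrib_left algebra_simps simp flip: to_ac_power)

lemma linpoly_GFext:
  assumes "primepow CARD('a::{field,finite})"
    and "a \<in> {..<t} \<rightarrow> GFext m" "x \<in> GFext m"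
  shows "linpoly t a (x :: 'a alg_closure) \<in> GFext m"
proof -
  have "(x ^ (CARD('a) ^ i)) ^ (CARD('a) ^ m) = x ^ (CARD('a) ^ i)" for i
  proof -
    have "(x ^ (CARD('a) ^ i)) ^ (CARD('a) ^ m) = (x ^ (CARD('a) ^ m)) ^ (CARD('a) ^ i)"
      by (simp add: mult.commute flip: power_mult)
    then show ?thesis using assms(3) by (simp add: GFext_def)
  qed
  then show ?thesis
    using assms(2) by (auto simp: GFext_def linpoly_def frobenius_sum[OF assms(1)] power_mult_distrib
        intro!: sum.cong)
qed

text \<open>The difference of two distinct linearised polynomials is a nonzero polynomial of degree at most
\<open>q^(t - 1)\<close>, so two of them agree on a space of dimension less than \<open>t\<close>. This is what bounds
the intersections in the code.\<close>

lemma card_linpoly_agree: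
  fixes a b :: "nat \<Rightarrow> 'a::{field,finite} alg_closure"
  assumes i: "i < t" "a i \<noteq> b i"
  shows "finite {x. linpoly t a x = linpoly t b x}"
    and "card {x. linpoly t a x = linpoly t b x} < CARD('a) ^ t"
proof -
  let ?q = "CARD('a)"
  define p where "p = (\<Sum>j<t. monom (a j - b j) (?q ^ j))"
  have q2: "?q \<ge> 2" by (rule CARD_field_ge_2)
  have "coeff p (?q ^ i) = (\<Sum>j<t. if j = i then a i - b i else 0)"
    using q2 unfolding p_def coeff_sum by (intro sum.cong) (auto simp: power_inject_exp)
  also have "\<dots> = a i - b i" using i by simp
  finally have p0: "p \<noteq> 0" using i by auto
  have roots: "{x. linpoly t a x = linpoly t b x} = {x. poly p x = 0}"
    by (auto simp: p_def linpoly_def poly_sum poly_monom left_diff_distrib sum_subtractf)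
  show "finite {x. linpoly t a x = linpoly t b x}"
    unfolding roots using p0 by (rule poly_roots_finite)
  have "degree p \<le> ?q ^ (t - 1)"
    unfolding p_def
  proof (rule degree_sum_le)
    fix j assume "j \<in> {..<t}"
    then have "?q ^ j \<le> ?q ^ (t - 1)" using q2 by (intro power_increasing) auto
    then show "degree (monom (a j - b j) (?q ^ j)) \<le> ?q ^ (t - 1)"
      using degree_monom_le[of "a j - b j" "?q ^ j"] by linarith
  qed simp
  also have "?q ^ (t - 1) < ?q ^ t" using q2 i by (intro power_strict_increasing) auto
  finally show "card {x. linpoly t a x = linpoly t b x} < ?q ^ t"
    unfolding roots using card_poly_roots_bound[OF p0] by linarith
qed

section \<open>Linear isomorphisms of finite flags\<close>

text \<open>Bases adapted to both flags are matched with each other. Taking \<open>V = W\<close> yields an isomorphism of two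
spaces of the same size. Taking \<open>W = Fn n\<close> on both sides yields an automorphism that carries one subspace to another.\<close>

lemma (in vector_space_pair) linear_bij_betw_flags:
  assumes fin: "finite (UNIV :: 'a set)"
    and V: "vs1.subspace V" "vs1.subspace W" "V \<subseteq> W" "finite W"
    and V': "vs2.subspace V'" "vs2.subspace W'" "V' \<subseteq> W'" "finite W'"
    and card: "card V = card V'" "card W = card W'"
  shows "\<exists>g. Vector_Spaces.linear s1 s2 g \<and> bij_betw g V V' \<and> bij_betw g W W'"
proof -
  have q2: "1 < CARD('a)"
  proof -
    have "card {0, 1 :: 'a} \<le> CARD('a)" by (intro card_mono fin) auto
    then show ?thesis by simp
  qed
  obtain B where B: "B \<subseteq> V" "vs1.independent B" "V \<subseteq> vs1.span B" "card B = vs1.dim V"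
    by (rule vs1.basis_exists)
  obtain C where C: "B \<subseteq> C" "C \<subseteq> W" "vs1.independent C" "W \<subseteq> vs1.span C"
    using vs1.maximal_independent_subset_extend[of B W, OF subset_trans[OF B(1) V(3)] B(2)] by blast
  obtain B' where B': "B' \<subseteq> V'" "vs2.independent B'" "V' \<subseteq> vs2.span B'" "card B' = vs2.dim V'"
    by (rule vs2.basis_exists)
  obtain C' where C': "B' \<subseteq> C'" "C' \<subseteq> W'" "vs2.independent C'" "W' \<subseteq> vs2.span C'"
    using vs2.maximal_independent_subset_extend[of B' W', OF subset_trans[OF B'(1) V'(3)] B'(2)] by blast
  have finC: "finite C" "finite C'" by (fact finite_subset[OF C(2) V(4)], fact finite_subset[OF C'(2) V'(4)])
  have cC: "card C = vs1.dim W" "card C' = vs2.dim W'"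
    using vs1.basis_card_eq_dim[OF C(2,4,3)] vs2.basis_card_eq_dim[OF C'(2,4,3)] by simp_all
  have finV: "finite V" "finite V'" by (fact finite_subset[OF V(3,4)], fact finite_subset[OF V'(3,4)])
  have "CARD('a) ^ card B = CARD('a) ^ card B'"
    using vs1.card_subspace[OF fin V(1) finV(1)] vs2.card_subspace[OF fin V'(1) finV(2)] B B' card
    by simp
  then have cB: "card B = card B'" using q2 power_inject_exp by blast
  have "CARD('a) ^ card C = CARD('a) ^ card C'"
    using vs1.card_subspace[OF fin V(2) V(4)] vs2.card_subspace[OF fin V'(2) V'(4)] cC card by simp
  then have "card C = card C'" using q2 power_inject_exp by blast
  then have "card (C - B) = card (C' - B')"
    using C(1) C'(1) cB finite_subset[OF C(1) finC(1)] finite_subset[OF C'(1) finC(2)]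
    by (simp add: card_Diff_subset)
  then obtain f2 where f2: "bij_betw f2 (C - B) (C' - B')"
    using finC finite_same_card_bij[of "C - B" "C' - B'"] by blast
  obtain f1 where f1: "bij_betw f1 B B'"
    using finite_same_card_bij[OF _ _ cB] finite_subset[OF C(1) finC(1)] finite_subset[OF C'(1) finC(2)] by blast
  obtain g where g: "Vector_Spaces.linear s1 s2 g" "\<forall>x\<in>C. g x = (if x \<in> B then f1 x else f2 x)"
    using linear_independent_extend[OF C(3), of "\<lambda>x. if x \<in> B then f1 x else f2 x"] by blast
  have gB: "g ` B = B'"
  proof -
    have "g ` B = f1 ` B" using g(2) C(1) by (intro image_cong) auto
    then show ?thesis using f1 by (simp add: bij_betw_def)
  qed
  have gC: "g ` C = C'"
  proof -
    have "g ` (C - B) = f2 ` (C - B)" using g(2) by (intro image_cong) auto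
    then have "g ` (C - B) = C' - B'" using f2 by (simp add: bij_betw_def)
    moreover have "C = B \<union> (C - B)" "C' = B' \<union> (C' - B')" using C(1) C'(1) by auto
    ultimately show ?thesis using gB by (metis image_Un)
  qed
  interpret g: Vector_Spaces.linear s1 s2 g by fact
  have "vs1.span B = V" "vs2.span B' = V'"
    using vs1.span_minimal[OF B(1) V(1)] B(3) vs2.span_minimal[OF B'(1) V'(1)] B'(3)
    by (simp_all add: subset_antisym)
  moreover have "vs1.span C = W" "vs2.span C' = W'"
    using vs1.span_minimal[OF C(2) V(2)] C(4) vs2.span_minimal[OF C'(2) V'(2)] C'(4)
    by (simp_all add: subset_antisym)
  ultimately have im: "g ` V = V'" "g ` W = W'"
    using g.span_image[of B] g.span_image[of C] gB gC by simp_all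
  then have "inj_on g W" using card V(4) by (intro eq_card_imp_inj_on) auto
  then have "inj_on g V" using V(3) inj_on_subset by blast
  then show ?thesis using g(1) im \<open>inj_on g W\<close> by (auto simp: bij_betw_def)
qed

section \<open>Lifted rank metric codes\<close>

interpretation fvec_pair: vector_space_pair
  "fscale :: 'a::field \<Rightarrow> (nat \<Rightarrow> 'a) \<Rightarrow> (nat \<Rightarrow> 'a)" "fscale :: 'a \<Rightarrow> (nat \<Rightarrow> 'a) \<Rightarrow> (nat \<Rightarrow> 'a)"
  by unfold_locales

interpretation fvec_avec: vector_space_pair
  "fscale :: 'a::field \<Rightarrow> (nat \<Rightarrow> 'a) \<Rightarrow> (nat \<Rightarrow> 'a)" "ascale :: 'a \<Rightarrow> 'a alg_closure \<Rightarrow> 'a alg_closure"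
  by unfold_locales

interpretation avec_fvec: vector_space_pair
  "ascale :: 'a::field \<Rightarrow> 'a alg_closure \<Rightarrow> 'a alg_closure" "fscale :: 'a \<Rightarrow> (nat \<Rightarrow> 'a) \<Rightarrow> (nat \<Rightarrow> 'a)"
  by unfold_locales

text \<open>The Gabidulin code: \<open>q^(t m)\<close> linear endomorphisms of an \<open>m\<close>-dimensional space, any two of which agree
only on a subspace of dimension less than \<open>t\<close>. They are the linearised polynomials with \<open>t\<close> coefficients in
\<open>GFext m\<close>, transported to \<open>Fn m\<close>.\<close>

lemma exists_rank_metric_code:
  assumes pp: "primepow CARD('a::{field,finite})" and m: "0 < m"
  shows "\<exists>I F. finite I \<and> card (I :: (nat \<Rightarrow> 'a alg_closure) set) = CARD('a) ^ (t * m) \<and>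
    (\<forall>a\<in>I. Vector_Spaces.linear fscale fscale (F a) \<and> F a ` Fn m \<subseteq> (Fn m :: (nat \<Rightarrow> 'a) set)) \<and>
    (\<forall>a\<in>I. \<forall>b\<in>I. a \<noteq> b \<longrightarrow> card {v \<in> Fn m. F a v = F b v} < CARD('a) ^ t)"
proof -
  let ?K = "GFext m :: 'a alg_closure set"
  let ?F = "Fn m :: (nat \<Rightarrow> 'a) set"
  have K: "avec.subspace ?K" "finite ?K" "card ?K = card ?F"
    using subspace_GFext[OF pp] finite_GFext[OF pp m] card_GFext[OF pp m] by (simp_all add: card_Fn)
  obtain \<psi> where \<psi>: "Vector_Spaces.linear fscale ascale \<psi>" "bij_betw \<psi> ?F ?K"
    using fvec_avec.linear_bij_betw_flags[OF finite_class.finite_UNIV subspace_Fn subspace_Fn subset_refl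
        finite_Fn K(1,1) subset_refl K(2) K(3)[symmetric] K(3)[symmetric]] by blast
  obtain \<chi> where \<chi>: "Vector_Spaces.linear ascale fscale \<chi>" "bij_betw \<chi> ?K ?F"
    using avec_fvec.linear_bij_betw_flags[OF finite_class.finite_UNIV K(1,1) subset_refl K(2)
        subspace_Fn subspace_Fn subset_refl finite_Fn K(3) K(3)] by blast
  define I where "I = (({..<t} \<rightarrow>\<^sub>E ?K) :: (nat \<Rightarrow> 'a alg_closure) set)"
  define F where "F a = \<chi> \<circ> linpoly t a \<circ> \<psi>" for a
  have lin: "Vector_Spaces.linear fscale fscale (F a)" for a
    unfolding F_def
    by (intro Vector_Spaces.linear_compose[OF \<psi>(1)] Vector_Spaces.linear_compose[OF linear_linpoly[OF pp] \<chi>(1)])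
  have mem: "linpoly t a (\<psi> v) \<in> ?K" if "a \<in> I" "v \<in> ?F" for a v
    using that \<psi>(2) by (intro linpoly_GFext[OF pp]) (auto simp: I_def bij_betw_def)
  have sub: "F a ` ?F \<subseteq> ?F" if "a \<in> I" for a
    using mem[OF that] \<chi>(2) by (auto simp: F_def bij_betw_def)
  have agree: "card {v \<in> ?F. F a v = F b v} < CARD('a) ^ t" if ab: "a \<in> I" "b \<in> I" "a \<noteq> b" for a b
  proof -
    obtain i where i: "i < t" "a i \<noteq> b i"
      using ab PiE_ext[of a "{..<t}" "\<lambda>_. ?K" b] by (auto simp: I_def)
    have "\<psi> ` {v \<in> ?F. F a v = F b v} \<subseteq> {x. linpoly t a x = linpoly t b x}"
    proof clarify
      fix v assume v: "v \<in> ?F" "F a v = F b v"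
      then show "linpoly t a (\<psi> v) = linpoly t b (\<psi> v)"
        using mem[OF ab(1)] mem[OF ab(2)] \<chi>(2) by (auto simp: F_def bij_betw_def inj_on_def)
    qed
    moreover have "inj_on \<psi> {v \<in> ?F. F a v = F b v}"
      using \<psi>(2) by (auto simp: bij_betw_def intro: inj_on_subset)
    ultimately have "card {v \<in> ?F. F a v = F b v} \<le> card {x. linpoly t a x = linpoly t b x}"
      using card_linpoly_agree(1)[of i t a b, OF i] by (intro card_inj_on_le[of \<psi>]) auto
    then show ?thesis using card_linpoly_agree(2)[of i t a b, OF i] by linarith
  qed
  have "finite I" unfolding I_def using K(2) by (intro finite_PiE) auto
  moreover have "card I = CARD('a) ^ (t * m)"
    unfolding I_def using K(3) by (simp add: card_PiE card_Fn mult.commute flip: power_mult)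
  ultimately show ?thesis using lin sub agree by blast
qed

text \<open>The graph of \<open>f\<close> on \<open>Fn k\<close>, with the values of \<open>f\<close> written into the coordinates from \<open>k\<close> on.\<close>

definition graph_space :: "nat \<Rightarrow> ((nat \<Rightarrow> 'a) \<Rightarrow> (nat \<Rightarrow> 'a)) \<Rightarrow> (nat \<Rightarrow> 'a::field) set" where
  "graph_space k f = (\<lambda>v. v + (\<lambda>i. if i < k then 0 else f v (i - k))) ` Fn k"

lemma graph_space_proj:
  assumes "v \<in> Fn k" "w = v + (\<lambda>i. if i < k then 0 else f v (i - k))"
  shows "v = (\<lambda>i. if i < k then w i else 0)" "f v = (\<lambda>i. w (i + k))"
  using assms by (auto simp: Fn_def fun_eq_iff)

lemma graph_space_inj: "inj_on (\<lambda>v. v + (\<lambda>i. if i < k then 0 else f v (i - k))) (Fn k)"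
  using graph_space_proj(1)[where f=f] by (intro inj_onI) metis

lemma graph_space_Omega:
  assumes f: "Vector_Spaces.linear fscale fscale f" "f ` Fn m \<subseteq> (Fn m :: (nat \<Rightarrow> 'a::field) set)" and k: "k \<le> m"
  shows "graph_space k f \<in> Omega (k + m)"
proof -
  interpret f: Vector_Spaces.linear fscale fscale f by fact
  let ?g = "\<lambda>v. v + (\<lambda>i. if i < k then 0 else f v (i - k))"
  have "Vector_Spaces.linear fscale fscale ?g"
    unfolding Vector_Spaces.linear_iff
    by (auto simp: fvec.vector_space_axioms f.add f.scale[unfolded fscale_def] fun_eq_iff fscale_def distrib_left)
  then interpret g: Vector_Spaces.linear fscale fscale ?g .
  have "fvec.subspace (graph_space k f)"
    unfolding graph_space_def by (rule g.subspace_image[OF subspace_Fn])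
  moreover have "graph_space k f \<subseteq> Fn (k + m)"
  proof
    fix w assume "w \<in> graph_space k f"
    then obtain v where v: "v \<in> Fn k" "w = ?g v" by (auto simp: graph_space_def)
    have "f v \<in> Fn m" using v(1) k f(2) Fn_mono by blast
    then show "w \<in> Fn (k + m)" using v by (auto simp: Fn_def)
  qed
  ultimately show ?thesis by (simp add: Omega_def)
qed

lemma card_graph_space:
  fixes f :: "(nat \<Rightarrow> 'a::field) \<Rightarrow> (nat \<Rightarrow> 'a)"
  shows "card (graph_space k f) = card (Fn k :: (nat \<Rightarrow> 'a) set)"
  unfolding graph_space_def by (rule card_image[OF graph_space_inj])

lemma card_graph_space_Int:
  "card (graph_space k f \<inter> graph_space k g) = card {v \<in> Fn k. f v = g v}"
proof -
  let ?h = "\<lambda>v. v + (\<lambda>i. if i < k then 0 else f v (i - k))"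
  have "graph_space k f \<inter> graph_space k g = ?h ` {v \<in> Fn k. f v = g v}"
  proof (intro Set.set_eqI iffI)
    fix w assume "w \<in> graph_space k f \<inter> graph_space k g"
    then obtain u v where u: "u \<in> Fn k" "w = ?h u"
      and v: "v \<in> Fn k" "w = v + (\<lambda>i. if i < k then 0 else g v (i - k))" by (auto simp: graph_space_def)
    have "u = v" by (rule trans[OF graph_space_proj(1)[of u k w f, OF u] graph_space_proj(1)[of v k w g, OF v, symmetric]])
    moreover have "f u = g v"
      by (rule trans[OF graph_space_proj(2)[of u k w f, OF u] graph_space_proj(2)[of v k w g, OF v, symmetric]])
    ultimately show "w \<in> ?h ` {v \<in> Fn k. f v = g v}" using u by blast
  next
    fix w assume "w \<in> ?h ` {v \<in> Fn k. f v = g v}"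
    then obtain v where v: "v \<in> Fn k" "f v = g v" "w = ?h v" by blast
    have "w = v + (\<lambda>i. if i < k then 0 else g v (i - k))" by (simp only: v(2,3))
    then show "w \<in> graph_space k f \<inter> graph_space k g"
      using v(1,3) unfolding graph_space_def by blast
  qed
  then show ?thesis
    using card_image[OF inj_on_subset[OF graph_space_inj[of k f], of "{v \<in> Fn k. f v = g v}"]] by auto
qed

text \<open>Two graphs intersect exactly over the vectors on which the maps agree, so the graphs of a rank metric
code are subspaces with small pairwise intersections. The condition \<open>k \<le> m\<close>, which lets \<open>Fn k\<close> be a
domain inside \<open>Fn m\<close>, is the origin of the restriction to dimensions at most \<open>n/2\<close>.\<close>

lemma exists_lifted_code:
  assumes pp: "primepow CARD('a::{field,finite})" and m: "0 < m" "k \<le> m"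
  shows "\<exists>(I :: (nat \<Rightarrow> 'a alg_closure) set) V. finite I \<and> card I = CARD('a) ^ (t * m) \<and>
    (\<forall>a\<in>I. V a \<in> Omega (k + m) \<and> fvec.dim (V a :: (nat \<Rightarrow> 'a) set) = k) \<and>
    (\<forall>a\<in>I. \<forall>b\<in>I. a \<noteq> b \<longrightarrow> fvec.dim (V a \<inter> V b) < t)"
proof -
  let ?q = "CARD('a)"
  have q2: "1 < ?q" using CARD_field_ge_2[where 'a='a] by simp
  obtain I F where F: "finite I" "card (I :: (nat \<Rightarrow> 'a alg_closure) set) = ?q ^ (t * m)"
    "\<forall>a\<in>I. Vector_Spaces.linear fscale fscale (F a) \<and> F a ` Fn m \<subseteq> (Fn m :: (nat \<Rightarrow> 'a) set)"
    "\<forall>a\<in>I. \<forall>b\<in>I. a \<noteq> b \<longrightarrow> card {v \<in> Fn m. F a v = F b v} < ?q ^ t"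
    using exists_rank_metric_code[OF pp m(1), of t] by blast
  define V where "V a = graph_space k (F a)" for a
  have O: "V a \<in> Omega (k + m)" if "a \<in> I" for a
    unfolding V_def using F(3) that m(2) by (intro graph_space_Omega) auto
  have d: "fvec.dim (V a) = k" if "a \<in> I" for a
  proof -
    have "?q ^ fvec.dim (V a) = ?q ^ k"
      using card_in_Omega[OF O[OF that]] by (simp add: V_def card_graph_space card_Fn)
    then show ?thesis using q2 power_inject_exp by blast
  qed
  have i: "fvec.dim (V a \<inter> V b) < t" if ab: "a \<in> I" "b \<in> I" "a \<noteq> b" for a b
  proof -
    have "?q ^ fvec.dim (V a \<inter> V b) = card {v \<in> Fn k. F a v = F b v}"
      using card_in_Omega[OF Omega_Int[OF O[OF ab(1)] O[OF ab(2)]]] by (simp add: V_def card_graph_space_Int)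
    also have "\<dots> \<le> card {v \<in> Fn m. F a v = F b v}"
      using finite_Fn[of m, where 'a='a] Fn_mono[OF m(2)] by (intro card_mono) auto
    also have "\<dots> < ?q ^ t" using F(4) ab by blast
    finally show ?thesis using q2 power_less_imp_less_exp by blast
  qed
  show ?thesis using F(1,2) O d i by blast
qed

section \<open>Averaging over the general linear group\<close>

text \<open>The automorphisms of \<open>Fn n\<close> are represented by permutations that fix all vectors outside \<open>Fn n\<close>, so that
they form a finite set closed under composition of functions.\<close>

definition GLn :: "nat \<Rightarrow> ((nat \<Rightarrow> 'a::field) \<Rightarrow> (nat \<Rightarrow> 'a)) set" where
  "GLn n = {p. p permutes Fn n \<and> (\<forall>u\<in>Fn n. \<forall>v\<in>Fn n. p (u + v) = p u + p v) \<and>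
     (\<forall>c. \<forall>v\<in>Fn n. p (fscale c v) = fscale c (p v))}"

lemma finite_GLn: "finite (GLn n :: ((nat \<Rightarrow> 'a::{field,finite}) \<Rightarrow> _) set)"
  by (rule finite_subset[OF _ finite_permutations[OF finite_Fn[of n]]]) (auto simp: GLn_def)

lemma id_GLn: "id \<in> GLn n"
  by (auto simp: GLn_def permutes_id)

lemma GLn_compose:
  assumes "g \<in> GLn n" "h \<in> GLn n"
  shows "h \<circ> g \<in> GLn n"
proof -
  have "g v \<in> Fn n" if "v \<in> Fn n" for v
    using assms(1) that by (simp add: GLn_def permutes_in_image)
  then show ?thesis using assms by (auto simp: GLn_def permutes_compose)
qed

lemma GLn_inj: "g \<in> GLn n \<Longrightarrow> inj g"
  by (auto simp: GLn_def permutes_inj)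

lemma GLn_image_Omega:
  assumes g: "g \<in> GLn n" and x: "x \<in> Omega n"
  shows "g ` x \<in> Omega n"
proof -
  have xF: "x \<subseteq> Fn n" and sub: "fvec.subspace x" using OmegaD[OF x] by auto
  have gF: "g ` x \<subseteq> Fn n" using g xF by (auto simp: GLn_def permutes_in_image)
  have "g 0 = fscale 0 (g 0)" using g by (auto simp: GLn_def dest!: spec[of _ 0] bspec[of _ _ 0])
  then have g0: "g 0 = 0" by simp
  have "fvec.subspace (g ` x)"
    unfolding fvec.subspace_def
  proof (intro conjI ballI allI)
    show "0 \<in> g ` x" using g0 fvec.subspace_0[OF sub] by (metis imageI)
  next
    fix a b assume "a \<in> g ` x" "b \<in> g ` x"
    then obtain u v where "u \<in> x" "v \<in> x" "a = g u" "b = g v" by blast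
    then have "a + b = g (u + v)" "u + v \<in> x"
      using g xF fvec.subspace_add[OF sub] by (auto simp: GLn_def subset_iff)
    then show "a + b \<in> g ` x" by blast
  next
    fix c a assume "a \<in> g ` x"
    then obtain u where "u \<in> x" "a = g u" by blast
    then have "fscale c a = g (fscale c u)" "fscale c u \<in> x"
      using g xF fvec.subspace_scale[OF sub] by (auto simp: GLn_def subset_iff)
    then show "fscale c a \<in> g ` x" by blast
  qed
  then show ?thesis using gF by (simp add: Omega_def)
qed

lemma GLn_dim_image:
  assumes g: "g \<in> GLn n" and x: "(x :: (nat \<Rightarrow> 'a::{field,finite}) set) \<in> Omega n"
  shows "fvec.dim (g ` x) = fvec.dim x"
proof -
  have "card (g ` x) = card x" by (rule card_image[OF inj_on_subset[OF GLn_inj[OF g]]]) simp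
  then have "CARD('a) ^ fvec.dim (g ` x) = CARD('a) ^ fvec.dim x"
    using card_in_Omega[OF x] card_in_Omega[OF GLn_image_Omega[OF g x]] by simp
  then show ?thesis using CARD_field_ge_2[where 'a='a] by (subst (asm) power_inject_exp) auto
qed

lemma GLn_transitive:
  fixes x y :: "(nat \<Rightarrow> 'a::{field,finite}) set"
  assumes x: "x \<in> Omega n" and y: "y \<in> Omega n" and d: "fvec.dim x = fvec.dim y"
  shows "\<exists>h\<in>GLn n. h ` x = y"
proof -
  have c: "card x = card y" using d by (simp add: card_in_Omega[OF x] card_in_Omega[OF y])
  obtain g where g: "Vector_Spaces.linear fscale fscale g" "bij_betw g x y" "bij_betw g (Fn n) (Fn n)"
    using fvec_pair.linear_bij_betw_flags[OF finite_class.finite_UNIV OmegaD(1)[OF x] subspace_Fn OmegaD(2)[OF x]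
        finite_Fn OmegaD(1)[OF y] subspace_Fn OmegaD(2)[OF y] finite_Fn c refl] by blast
  interpret g: Vector_Spaces.linear fscale fscale g by fact
  define h where "h v = (if v \<in> Fn n then g v else v)" for v
  have "bij_betw h (Fn n) (Fn n)" using g(3) bij_betw_cong[of "Fn n" g h] by (simp add: h_def)
  then have "h permutes Fn n" by (rule bij_imp_permutes) (simp add: h_def)
  then have "h \<in> GLn n" by (simp add: GLn_def h_def g.add g.scale)
  moreover have "h ` x = g ` x" using OmegaD(2)[OF x] by (intro image_cong) (auto simp: h_def)
  ultimately show ?thesis using g(2) by (auto simp: bij_betw_def)
qed

text \<open>Composition with an automorphism that carries \<open>x\<close> to \<open>y\<close> is injective. By symmetry, the number of automorphisms
that carry \<open>v\<close> to \<open>x\<close> depends only on the dimension of \<open>x\<close>.\<close>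

lemma card_GLn_mapping_le:
  fixes x y v :: "(nat \<Rightarrow> 'a::{field,finite}) set"
  assumes "x \<in> Omega n" "y \<in> Omega n" "fvec.dim x = fvec.dim y"
  shows "card {g \<in> GLn n. g ` v = x} \<le> card {g \<in> GLn n. g ` v = y}"
proof -
  obtain h where h: "h \<in> GLn n" "h ` x = y" using GLn_transitive[OF assms] by blast
  show ?thesis
  proof (rule card_inj_on_le[of "\<lambda>g. h \<circ> g"])
    show "inj_on (\<lambda>g. h \<circ> g) {g \<in> GLn n. g ` v = x}"
      using GLn_inj[OF h(1)] by (intro inj_on_subset[OF fun.inj_map]) auto
    show "(\<lambda>g. h \<circ> g) ` {g \<in> GLn n. g ` v = x} \<subseteq> {g \<in> GLn n. g ` v = y}"
      using h GLn_compose by (auto simp: image_comp[symmetric])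
  qed (simp add: finite_GLn)
qed

lemma sum_card_GLn_mapping:
  fixes W :: "(nat \<Rightarrow> 'a::{field,finite}) set set"
  assumes "finite W"
  shows "(\<Sum>x\<in>W. card {g \<in> GLn n. g ` v = x}) = card {g \<in> GLn n. g ` v \<in> W}"
proof -
  have "{g \<in> GLn n. g ` v \<in> W} = (\<Union>x\<in>W. {g \<in> GLn n. g ` v = x})" by auto
  then show ?thesis
    using assms by (simp add: card_UN_disjoint finite_GLn disjoint_iff)
qed

text \<open>Count the pairs of an automorphism \<open>g\<close> and a member \<open>V a\<close> of the lifted code with \<open>g ` V a\<close> in \<open>U\<close>. Two different
members have images meeting in dimension less than \<open>t\<close>, so each \<open>g\<close> occurs at most once. On the other hand,
for each \<open>a\<close> the image \<open>g ` V a\<close> is uniformly distributed over all \<open>k\<close>-dimensional subspaces.\<close>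

theorem card_t_intersecting_layer:
  fixes U :: "(nat \<Rightarrow> 'a::{field,finite}) set set"
  assumes pp: "primepow CARD('a)" and U: "U \<subseteq> Omega n" "t_intersecting t U"
    and k: "2 * k \<le> n" "0 < n"
  shows "card {x \<in> U. fvec.dim x = k} * CARD('a) ^ (t * (n - k)) \<le> card {x \<in> Omega n. fvec.dim (x :: (nat \<Rightarrow> 'a) set) = k}"
proof -
  define U' where "U' = {x \<in> U. fvec.dim x = k}"
  define W where "W = {x \<in> Omega n. fvec.dim (x :: (nat \<Rightarrow> 'a) set) = k}"
  let ?G = "GLn n :: ((nat \<Rightarrow> 'a) \<Rightarrow> _) set"
  have finW: "finite W" by (rule finite_subset[OF _ finite_Omega[of n]]) (auto simp: W_def)
  have UW: "U' \<subseteq> W" using U by (auto simp: U'_def W_def)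
  then have finU: "finite U'" using finW finite_subset by blast
  obtain I :: "(nat \<Rightarrow> 'a alg_closure) set" and V
    where I: "finite I" "card I = CARD('a) ^ (t * (n - k))"
      and V: "\<And>a. a \<in> I \<Longrightarrow> V a \<in> W"
      and int: "\<And>a b. a \<in> I \<Longrightarrow> b \<in> I \<Longrightarrow> a \<noteq> b \<Longrightarrow> fvec.dim (V a \<inter> V b) < t"
  proof -
    have m: "0 < n - k" "k \<le> n - k" "k + (n - k) = n" using k by simp_all
    show thesis using exists_lifted_code[OF pp m(1,2), of t] that unfolding W_def m(3) by blast
  qed
  have hits: "card W * card {g \<in> ?G. g ` V a \<in> U'} = card U' * card ?G" if a: "a \<in> I" for a
  proof -
    \<comment> \<open>\<open>s\<close> is the number of automorphisms that carry \<open>V a\<close> to any given subspace of dimension \<open>k\<close>.\<close>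
    obtain s where s: "card {g \<in> ?G. g ` V a = x} = s" if "x \<in> W" for x
    proof (cases "W = {}")
      case False
      then obtain y where y: "y \<in> W" by blast
      have "card {g \<in> ?G. g ` V a = x} = card {g \<in> ?G. g ` V a = y}" if "x \<in> W" for x
        using that y by (intro antisym card_GLn_mapping_le) (auto simp: W_def)
      then show ?thesis using that by blast
    qed (use that in auto)
    have "g ` V a \<in> W" if "g \<in> ?G" for g
      using V[OF a] GLn_image_Omega[OF that] GLn_dim_image[OF that] by (auto simp: W_def)
    then have "{g \<in> ?G. g ` V a \<in> W} = ?G" by auto
    then have "card W * s = card ?G"
      using sum_card_GLn_mapping[OF finW, of n "V a"] s by simp
    moreover have "card U' * s = card {g \<in> ?G. g ` V a \<in> U'}"
      using sum_card_GLn_mapping[OF finU, of n "V a"] s UW by (simp add: subset_iff)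
    ultimately show ?thesis by (metis mult.assoc mult.left_commute)
  qed
  \<comment> \<open>The images of the code words under \<open>g\<close> still meet in dimension less than \<open>t\<close>.\<close>
  have one: "card {a \<in> I. g ` V a \<in> U'} \<le> 1" if g: "g \<in> ?G" for g
  proof -
    have "a = b" if ab: "a \<in> I" "b \<in> I" "g ` V a \<in> U'" "g ` V b \<in> U'" for a b
    proof (rule ccontr)
      assume "a \<noteq> b"
      have "V a \<in> Omega n" "V b \<in> Omega n" using V ab by (auto simp: W_def)
      then have "fvec.dim (g ` V a \<inter> g ` V b) = fvec.dim (V a \<inter> V b)"
        using GLn_dim_image[OF g Omega_Int] image_Int[OF GLn_inj[OF g]] by metis
      moreover have "t \<le> fvec.dim (g ` V a \<inter> g ` V b)"
        using U(2) ab by (auto simp: t_intersecting_def U'_def)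
      ultimately show False using int[OF ab(1,2) \<open>a \<noteq> b\<close>] by simp
    qed
    then show ?thesis using I(1) by (intro card_le_Suc0_iff_eq[THEN iffD2, simplified One_nat_def[symmetric]]) auto
  qed
  have "card I * (card U' * card ?G) = card W * (\<Sum>a\<in>I. card {g \<in> ?G. g ` V a \<in> U'})"
    by (simp add: sum_distrib_left hits)
  also have "(\<Sum>a\<in>I. card {g \<in> ?G. g ` V a \<in> U'}) = (\<Sum>g\<in>?G. card {a \<in> I. g ` V a \<in> U'})"
    using sum.swap_restrict[OF I(1) finite_GLn[of n], of "\<lambda>_ _. 1 :: nat" "\<lambda>a g. g ` V a \<in> U'"]
    by (simp add: card_eq_sum del: sum_constant)
  also have "\<dots> \<le> (\<Sum>g\<in>?G. 1)" by (rule sum_mono[OF one])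
  finally have "(card I * card U') * card ?G \<le> card W * card ?G" by (simp add: mult.assoc)
  moreover have "0 < card ?G" using id_GLn finite_GLn by (auto simp: card_gt_0_iff)
  ultimately have "card I * card U' \<le> card W" by simp
  then show ?thesis by (simp add: I(2) U'_def W_def mult.commute)
qed

section \<open>Moments of the biased measure\<close>

lemma prod_one_plus_pos: "0 < \<sigma> \<Longrightarrow> 0 < (\<Prod>j\<in>J. 1 + \<sigma> * real q ^ j)" for \<sigma> :: real
  by (intro prod_pos) (simp add: add_pos_nonneg)

lemma one_plus_ne_0: "0 < \<sigma> \<Longrightarrow> 1 + \<sigma> * real q ^ j \<noteq> 0" for \<sigma> :: real
  using prod_one_plus_pos[of \<sigma> q "{j}"] by simp

lemma phi_nonneg: "0 < \<sigma> \<Longrightarrow> 0 \<le> phi q \<sigma> n k"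
  unfolding phi_def by (intro divide_nonneg_nonneg prod_nonneg) auto

lemma sum_power_phi:
  assumes "0 < \<sigma>"
  shows "(\<Sum>x\<in>Omega n. z ^ fvec.dim (x :: (nat \<Rightarrow> 'a::{field,finite}) set) * phi CARD('a) \<sigma> n (fvec.dim x)) =
    (\<Prod>j<n. 1 + z * \<sigma> * real CARD('a) ^ j) / (\<Prod>j<n. 1 + \<sigma> * real CARD('a) ^ j)"
proof -
  have "Fn 0 \<subseteq> x" if "x \<in> Omega n" for x :: "(nat \<Rightarrow> 'a) set"
    using fvec.subspace_0[OF OmegaD(1)[OF that]] by (auto simp: Fn_def zero_fun_def fun_eq_iff[symmetric])
  then have all: "{x. x \<in> Omega n \<and> Fn 0 \<subseteq> x} = (Omega n :: (nat \<Rightarrow> 'a) set set)" by auto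
  have "(\<Sum>x\<in>Omega n. (z * \<sigma>) ^ fvec.dim (x :: (nat \<Rightarrow> 'a) set) * real CARD('a) ^ (fvec.dim x choose 2))
      = (\<Prod>j<n. 1 + z * \<sigma> * real CARD('a) ^ j)"
    using subspace_generating_function[where 'a='a, of 0 n "z * \<sigma>"]
    by (simp add: all binomial_eq_0 lessThan_atLeast0)
  then show ?thesis
    by (simp add: phi_def power_mult_distrib mult.assoc flip: sum_divide_distrib)
qed

lemma prod_lessThan_add:
  fixes a b :: nat and f :: "nat \<Rightarrow> real"
  shows "(\<Prod>j<a + b. f j) = (\<Prod>j<a. f j) * (\<Prod>j<b. f (a + j))"
  by (induction b) (simp_all add: mult.assoc)

text \<open>Replacing \<open>\<sigma>\<close> by \<open>q^s \<sigma>\<close> shifts the index of the product by \<open>s\<close>, so numerator and denominator share all but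
\<open>s\<close> factors.\<close>

lemma moment_phi:
  assumes "0 < \<sigma>"
  shows "(\<Sum>x\<in>Omega n. (real CARD('a) ^ s) ^ fvec.dim (x :: (nat \<Rightarrow> 'a::{field,finite}) set) * phi CARD('a) \<sigma> n (fvec.dim x)) =
    (\<Prod>j<s. 1 + \<sigma> * real CARD('a) ^ n * real CARD('a) ^ j) / (\<Prod>j<s. 1 + \<sigma> * real CARD('a) ^ j)"
proof -
  let ?f = "\<lambda>j. 1 + \<sigma> * real CARD('a) ^ j"
  have "(\<Prod>j<n. ?f j) * (\<Prod>j<s. ?f (n + j)) = (\<Prod>j<s. ?f j) * (\<Prod>j<n. ?f (s + j))"
    using prod_lessThan_add[of ?f n s] prod_lessThan_add[of ?f s n] add.commute[of s n] by metis
  moreover have "0 < prod ?f {..<n}" "0 < prod ?f {..<s}" using prod_one_plus_pos[OF assms] by blast+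
  moreover have "d / a = b / c" if "a * b = c * d" "0 < a" "0 < c" for a b c d :: real
    using that by (simp add: field_simps)
  ultimately have "(\<Prod>j<n. ?f (s + j)) / (\<Prod>j<n. ?f j) = (\<Prod>j<s. ?f (n + j)) / (\<Prod>j<s. ?f j)"
    by blast
  then show ?thesis
    using sum_power_phi[OF assms, of "real CARD('a) ^ s" n, where 'a='a] by (simp add: power_add mult_ac)
qed

lemma moment_phi_le:
  assumes "0 < \<sigma>" and Q: "1 \<le> \<sigma> * real CARD('a) ^ n"
  shows "(\<Sum>x\<in>Omega n. (real CARD('a) ^ s) ^ fvec.dim (x :: (nat \<Rightarrow> 'a::{field,finite}) set) * phi CARD('a) \<sigma> n (fvec.dim x))
    \<le> (2 * real CARD('a) ^ s) ^ s * (\<sigma> * real CARD('a) ^ n) ^ s"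
proof -
  let ?q = "real CARD('a)" and ?Q = "\<sigma> * real CARD('a) ^ n"
  have q1: "1 \<le> ?q" using CARD_field_ge_2[where 'a='a] by simp
  have "(\<Prod>j<s. 1 + ?Q * ?q ^ j) / (\<Prod>j<s. 1 + \<sigma> * ?q ^ j) \<le> (\<Prod>j<s. 1 + ?Q * ?q ^ j) / 1"
    using assms by (intro divide_left_mono prod_nonneg prod_ge_1 mult_pos_pos prod_one_plus_pos) auto
  also have "\<dots> \<le> (\<Prod>j<s. 2 * ?q ^ s * ?Q)"
    unfolding div_by_1
  proof (intro prod_mono conjI)
    fix j assume j: "j \<in> {..<s}"
    have "?Q * ?q ^ j \<le> ?Q * ?q ^ s" using q1 j Q by (intro mult_left_mono power_increasing) auto
    moreover have "1 * 1 \<le> ?Q * ?q ^ s" using q1 Q by (intro mult_mono one_le_power) auto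
    ultimately show "1 + ?Q * ?q ^ j \<le> 2 * ?q ^ s * ?Q" by (simp add: mult_ac)
  qed (use assms in auto)
  finally show ?thesis using assms(1) by (simp add: moment_phi power_mult_distrib)
qed

lemma mu_nonneg: "0 < \<sigma> \<Longrightarrow> 0 \<le> mu \<sigma> n U"
  unfolding mu_def by (intro sum_nonneg phi_nonneg)

lemma mu_Omega: "0 < \<sigma> \<Longrightarrow> mu \<sigma> n (Omega n :: (nat \<Rightarrow> 'a::{field,finite}) set set) = 1"
  using sum_power_phi[of \<sigma> 1 n, where 'a='a] by (simp add: mu_def one_plus_ne_0)

lemma mu_le_1:
  assumes "0 < \<sigma>" "U \<subseteq> (Omega n :: (nat \<Rightarrow> 'a::{field,finite}) set set)"
  shows "mu \<sigma> n U \<le> 1"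
proof -
  have "mu \<sigma> n U \<le> mu \<sigma> n (Omega n :: (nat \<Rightarrow> 'a) set set)"
    unfolding mu_def using assms by (intro sum_mono2 finite_Omega phi_nonneg) auto
  then show ?thesis using mu_Omega[OF assms(1), of n, where 'a='a] by simp
qed

section \<open>Upper bound for t-intersecting families\<close>

text \<open>In dimension \<open>k\<close> the family has density at most \<open>q^(t k) / q^(t n)\<close>. Replacing \<open>U\<close> by all subspaces weighted
with this density leaves a moment of the full measure.\<close>

lemma mu_small_part_le:
  fixes U :: "(nat \<Rightarrow> 'a::{field,finite}) set set"
  assumes pp: "primepow CARD('a)" and \<sigma>: "0 < \<sigma>" and n: "0 < n"
    and U: "U \<subseteq> Omega n" "t_intersecting t U"
  shows "(\<Sum>x | x \<in> U \<and> 2 * fvec.dim x \<le> n. phi CARD('a) \<sigma> n (fvec.dim x)) \<le>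
    (\<Sum>x\<in>Omega n. (real CARD('a) ^ t) ^ fvec.dim (x :: (nat \<Rightarrow> 'a) set) * phi CARD('a) \<sigma> n (fvec.dim x)) /
      real CARD('a) ^ (t * n)"
proof -
  let ?q = "real CARD('a)" and ?\<phi> = "phi CARD('a) \<sigma> n"
  define T where "T = {k. 2 * k \<le> n}"
  have finT: "finite T" by (rule finite_subset[of _ "{..n}"]) (auto simp: T_def)
  let ?S = "{x. x \<in> U \<and> 2 * fvec.dim x \<le> n}"
  have finS: "finite ?S" by (rule finite_subset[OF _ finite_Omega[of n]]) (use U in auto)
  have layer: "(\<Sum>x | x \<in> ?S \<and> fvec.dim x = k. ?\<phi> (fvec.dim x)) \<le>
      (\<Sum>x | x \<in> Omega n \<and> fvec.dim (x :: (nat \<Rightarrow> 'a) set) = k. ?q ^ (t * fvec.dim x) / ?q ^ (t * n) * ?\<phi> (fvec.dim x))"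
    if k: "k \<in> T" for k
  proof -
    have k2: "2 * k \<le> n" using k by (simp add: T_def)
    have "real (card {x \<in> U. fvec.dim x = k}) * ?q ^ (t * (n - k)) \<le> real (card {x \<in> Omega n. fvec.dim (x :: (nat \<Rightarrow> 'a) set) = k})"
      using card_t_intersecting_layer[OF pp U k2 n] by (simp flip: of_nat_power of_nat_mult)
    moreover have "?q ^ (t * n) = ?q ^ (t * (n - k)) * ?q ^ (t * k)"
      using k2 by (simp flip: power_add distrib_left)
    ultimately have "real (card {x \<in> U. fvec.dim x = k}) \<le>
        real (card {x \<in> Omega n. fvec.dim (x :: (nat \<Rightarrow> 'a) set) = k}) * (?q ^ (t * k) / ?q ^ (t * n))"
      by (simp add: field_simps)
    then have "real (card {x \<in> U. fvec.dim x = k}) * ?\<phi> k \<le>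
        real (card {x \<in> Omega n. fvec.dim (x :: (nat \<Rightarrow> 'a) set) = k}) * (?q ^ (t * k) / ?q ^ (t * n)) * ?\<phi> k"
      using phi_nonneg[OF \<sigma>] by (rule mult_right_mono)
    moreover have "{x. x \<in> ?S \<and> fvec.dim x = k} = {x \<in> U. fvec.dim x = k}" using k2 by auto
    ultimately show ?thesis by (simp add: mult.assoc)
  qed
  have "(\<Sum>x\<in>?S. ?\<phi> (fvec.dim x)) = (\<Sum>k\<in>T. \<Sum>x | x \<in> ?S \<and> fvec.dim x = k. ?\<phi> (fvec.dim x))"
    by (rule sum.group[OF finS finT, symmetric]) (auto simp: T_def)
  also have "\<dots> \<le> (\<Sum>k\<in>T. \<Sum>x | x \<in> Omega n \<and> fvec.dim (x :: (nat \<Rightarrow> 'a) set) = k. ?q ^ (t * fvec.dim x) / ?q ^ (t * n) * ?\<phi> (fvec.dim x))"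
    by (rule sum_mono[OF layer])
  also have "\<dots> \<le> (\<Sum>k\<le>n. \<Sum>x | x \<in> Omega n \<and> fvec.dim (x :: (nat \<Rightarrow> 'a) set) = k. ?q ^ (t * fvec.dim x) / ?q ^ (t * n) * ?\<phi> (fvec.dim x))"
    using phi_nonneg[OF \<sigma>] by (intro sum_mono2 sum_nonneg) (auto simp: T_def)
  also have "\<dots> = (\<Sum>x\<in>Omega n. ?q ^ (t * fvec.dim (x :: (nat \<Rightarrow> 'a) set)) / ?q ^ (t * n) * ?\<phi> (fvec.dim x))"
    using dim_le_Omega[where 'a='a] by (intro sum.group finite_Omega) auto
  finally show ?thesis by (simp add: power_mult sum_divide_distrib)
qed

text \<open>Markov's inequality: \<open>1 \<le> q ^ (s * dim x) * q powr (- s n / 2)\<close> whenever \<open>2 * dim x \<ge> n\<close>.\<close>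

lemma mu_large_part_le:
  fixes U :: "(nat \<Rightarrow> 'a::{field,finite}) set set"
  assumes \<sigma>: "0 < \<sigma>" and U: "U \<subseteq> Omega n"
  shows "(\<Sum>x | x \<in> U \<and> \<not> 2 * fvec.dim x \<le> n. phi CARD('a) \<sigma> n (fvec.dim x)) \<le>
    (\<Sum>x\<in>Omega n. (real CARD('a) ^ s) ^ fvec.dim (x :: (nat \<Rightarrow> 'a) set) * phi CARD('a) \<sigma> n (fvec.dim x)) *
      real CARD('a) powr (- real s * real n / 2)"
proof -
  let ?q = "real CARD('a)" and ?\<phi> = "phi CARD('a) \<sigma> n"
  have q1: "1 \<le> ?q" using CARD_field_ge_2[where 'a='a] by simp
  have "(\<Sum>x | x \<in> U \<and> \<not> 2 * fvec.dim x \<le> n. ?\<phi> (fvec.dim x)) \<le>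
    (\<Sum>x | x \<in> U \<and> \<not> 2 * fvec.dim x \<le> n. (?q ^ s) ^ fvec.dim x * ?\<phi> (fvec.dim x) * ?q powr (- real s * real n / 2))"
  proof (rule sum_mono)
    fix x assume "x \<in> {x \<in> U. \<not> 2 * fvec.dim x \<le> n}"
    then have "real n / 2 \<le> real (fvec.dim x)" by auto
    then have "0 \<le> real s * (real (fvec.dim x) - real n / 2)" by simp
    then have "1 \<le> ?q powr (real s * (real (fvec.dim x) - real n / 2))"
      using q1 by (rule ge_one_powr_ge_zero[rotated])
    also have "\<dots> = (?q ^ s) ^ fvec.dim x * ?q powr (- real s * real n / 2)"
      using q1 by (simp add: powr_add[symmetric] powr_realpow[symmetric] powr_powr algebra_simps)
    finally have "1 * ?\<phi> (fvec.dim x) \<le> (?q ^ s) ^ fvec.dim x * ?q powr (- real s * real n / 2) * ?\<phi> (fvec.dim x)"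
      using phi_nonneg[OF \<sigma>] by (rule mult_right_mono)
    then show "?\<phi> (fvec.dim x) \<le> (?q ^ s) ^ fvec.dim x * ?\<phi> (fvec.dim x) * ?q powr (- real s * real n / 2)"
      by (simp add: mult_ac)
  qed
  also have "\<dots> \<le> (\<Sum>x\<in>Omega n. (?q ^ s) ^ fvec.dim (x :: (nat \<Rightarrow> 'a) set) * ?\<phi> (fvec.dim x) * ?q powr (- real s * real n / 2))"
    using phi_nonneg[OF \<sigma>] U by (intro sum_mono2 finite_Omega mult_nonneg_nonneg) auto
  finally show ?thesis by (simp add: sum_distrib_right)
qed

text \<open>The hypothesis on \<open>s\<close> makes the contribution of the dimensions above \<open>n/2\<close> decay at least as fast as that of
the dimensions up to \<open>n/2\<close>.\<close>

lemma mu_t_intersecting_le: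
  fixes U :: "(nat \<Rightarrow> 'a::{field,finite}) set set"
  assumes pp: "primepow CARD('a)" and n: "0 < n" and \<theta>: "0 < \<theta>"
    and s: "real t * (1 - \<theta>) \<le> real s * (1 / 2 - \<theta>)"
    and U: "U \<subseteq> Omega n" "t_intersecting t U"
  shows "mu (sigma_theta CARD('a) \<theta> n) n U \<le>
    ((2 * real CARD('a) ^ t) ^ t + (2 * real CARD('a) ^ s) ^ s) * (real CARD('a) powr (- (1 - \<theta>) * real t)) ^ n"
proof -
  let ?q = "real CARD('a)"
  define \<sigma> where "\<sigma> = sigma_theta CARD('a) \<theta> n"
  let ?\<phi> = "phi CARD('a) \<sigma> n"
  have q1: "1 \<le> ?q" "0 < ?q" using CARD_field_ge_2[where 'a='a] by simp_all
  have \<sigma>0: "0 < \<sigma>" using q1 by (simp add: \<sigma>_def sigma_theta_def)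
  have Q: "\<sigma> * ?q ^ n = ?q powr (\<theta> * real n)"
    using q1 by (simp add: \<sigma>_def sigma_theta_def powr_realpow[symmetric] powr_add[symmetric] algebra_simps)
  have Q1: "1 \<le> \<sigma> * ?q ^ n" unfolding Q using q1 \<theta> by (intro ge_one_powr_ge_zero) auto
  let ?R = "(?q powr (- (1 - \<theta>) * real t)) ^ n"
  have R: "?R = ?q powr (- (1 - \<theta>) * real t * real n)"
    using q1 by (simp add: powr_realpow[symmetric] powr_powr)
  have "mu \<sigma> n U = (\<Sum>x | x \<in> U \<and> 2 * fvec.dim x \<le> n. ?\<phi> (fvec.dim x)) +
      (\<Sum>x | x \<in> U \<and> \<not> 2 * fvec.dim x \<le> n. ?\<phi> (fvec.dim x))"
    unfolding mu_def using finite_subset[OF U(1) finite_Omega]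
    by (subst sum.union_disjoint[symmetric]) (auto intro!: sum.cong)
  also have "(\<Sum>x | x \<in> U \<and> 2 * fvec.dim x \<le> n. ?\<phi> (fvec.dim x)) \<le>
      (2 * ?q ^ t) ^ t * (\<sigma> * ?q ^ n) ^ t / ?q ^ (t * n)"
    by (rule order_trans[OF mu_small_part_le[OF pp \<sigma>0 n U] divide_right_mono[OF moment_phi_le[OF \<sigma>0 Q1]]]) simp
  also have "(2 * ?q ^ t) ^ t * (\<sigma> * ?q ^ n) ^ t / ?q ^ (t * n) = (2 * ?q ^ t) ^ t * ?R"
  proof -
    have eq: "(?q powr (\<theta> * real n)) ^ t / ?q ^ (t * n) = ?R"
      unfolding R using q1 by (simp add: powr_realpow[symmetric] powr_powr powr_diff[symmetric] algebra_simps)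
    show ?thesis unfolding Q times_divide_eq_right[symmetric] eq ..
  qed
  also have "(\<Sum>x | x \<in> U \<and> \<not> 2 * fvec.dim x \<le> n. ?\<phi> (fvec.dim x)) \<le>
      (2 * ?q ^ s) ^ s * (\<sigma> * ?q ^ n) ^ s * ?q powr (- real s * real n / 2)"
    by (rule order_trans[OF mu_large_part_le[OF \<sigma>0 U(1), of s] mult_right_mono[OF moment_phi_le[OF \<sigma>0 Q1]]]) simp
  also have "\<dots> \<le> (2 * ?q ^ s) ^ s * ?R"
  proof -
    have "(?q powr (\<theta> * real n)) ^ s * ?q powr (- real s * real n / 2) = ?q powr (- (real s * (1 / 2 - \<theta>)) * real n)"
      using q1 by (simp add: powr_realpow[symmetric] powr_powr powr_add[symmetric] algebra_simps)
    also have "\<dots> \<le> ?R"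
      unfolding R using s q1 by (intro powr_mono mult_right_mono) (auto simp: algebra_simps)
    finally show ?thesis unfolding Q mult.assoc by (intro mult_left_mono) auto
  qed
  finally show ?thesis by (simp add: \<sigma>_def distrib_right)
qed

section \<open>Families of large measure\<close>

lemma t_intersecting_over_Fn:
  "t_intersecting t {x. x \<in> Omega n \<and> (Fn t :: (nat \<Rightarrow> 'a::{field,finite}) set) \<subseteq> x}"
  unfolding t_intersecting_def
proof (intro ballI)
  fix x y :: "(nat \<Rightarrow> 'a) set"
  assume xy: "x \<in> {x. x \<in> Omega n \<and> Fn t \<subseteq> x}" "y \<in> {x. x \<in> Omega n \<and> Fn t \<subseteq> x}"
  then have O: "x \<inter> y \<in> Omega n" using Omega_Int by blast
  have "card (Fn t :: (nat \<Rightarrow> 'a) set) \<le> card (x \<inter> y)"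
    using xy finite_in_Omega[OF O] by (intro card_mono) auto
  moreover have "(Fn t :: (nat \<Rightarrow> 'a) set) \<in> Omega t" by (simp add: Omega_def subspace_Fn)
  ultimately show "t \<le> fvec.dim (x \<inter> y)" using card_le_iff_dim_le[of "Fn t" t "x \<inter> y" n] O by (simp add: dim_Fn)
qed

text \<open>The generating function of the subspaces above \<open>Fn t\<close> shares the factors with index at least \<open>t\<close> with the
normalising product. What remains of the latter has \<open>t\<close> factors, each at most \<open>2 q^t\<close>.\<close>

lemma mu_over_Fn_ge:
  assumes t: "t \<le> n" and \<sigma>: "0 < \<sigma>" "\<sigma> \<le> 1"
  shows "\<sigma> ^ t / (2 * real CARD('a) ^ t) ^ t \<le> mu \<sigma> n {x. x \<in> Omega n \<and> (Fn t :: (nat \<Rightarrow> 'a::{field,finite}) set) \<subseteq> x}"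
proof -
  let ?q = "real CARD('a)" and ?f = "\<lambda>j. 1 + \<sigma> * real CARD('a) ^ j"
  have q1: "1 \<le> ?q" using CARD_field_ge_2[where 'a='a] by simp
  have "prod ?f {..<n} = prod ?f {..<t} * prod ?f {t..<n}"
    using t by (subst prod.union_disjoint[symmetric]) (auto intro!: prod.cong)
  then have "mu \<sigma> n {x. x \<in> Omega n \<and> (Fn t :: (nat \<Rightarrow> 'a) set) \<subseteq> x} =
      \<sigma> ^ t * ?q ^ (t choose 2) * prod ?f {t..<n} / (prod ?f {..<t} * prod ?f {t..<n})"
    using subspace_generating_function[OF t, of \<sigma>, where 'a='a]
    by (simp add: mu_def phi_def flip: sum_divide_distrib)
  also have "\<dots> = \<sigma> ^ t * ?q ^ (t choose 2) / prod ?f {..<t}"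
    using \<sigma>(1) by (simp add: one_plus_ne_0)
  finally have mu: "mu \<sigma> n {x. x \<in> Omega n \<and> (Fn t :: (nat \<Rightarrow> 'a) set) \<subseteq> x} = \<sigma> ^ t * ?q ^ (t choose 2) / prod ?f {..<t}" .
  have "prod ?f {..<t} \<le> (\<Prod>j<t. 2 * ?q ^ t)"
  proof (intro prod_mono conjI)
    fix j assume j: "j \<in> {..<t}"
    have "\<sigma> * ?q ^ j \<le> 1 * ?q ^ t" using q1 j \<sigma> by (intro mult_mono power_increasing) auto
    moreover have "1 \<le> ?q ^ t" using q1 by (rule one_le_power)
    ultimately show "?f j \<le> 2 * ?q ^ t" by linarith
  qed (use \<sigma> in auto)
  then have "\<sigma> ^ t * 1 / (2 * ?q ^ t) ^ t \<le> \<sigma> ^ t * ?q ^ (t choose 2) / prod ?f {..<t}"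
    using \<sigma> q1 prod_one_plus_pos[OF \<sigma>(1)] by (intro frac_le mult_left_mono one_le_power) auto
  then show ?thesis by (simp add: mu)
qed

text \<open>Addition maps \<open>x \<times> y\<close> into \<open>Fn n\<close>, and two pairs with the same sum differ by a vector of \<open>x \<inter> y\<close>. In terms of
dimensions: \<open>dim x + dim y \<le> n + dim (x \<inter> y)\<close>.\<close>

lemma card_mult_le_card_Int:
  fixes x y :: "(nat \<Rightarrow> 'a::{field,finite}) set"
  assumes x: "x \<in> Omega n" and y: "y \<in> Omega n"
  shows "card x * card y \<le> CARD('a) ^ n * card (x \<inter> y)"
proof -
  let ?f = "\<lambda>(u, v). u + v"
  let ?fib = "\<lambda>w. {p \<in> x \<times> y. ?f p = w}"
  have fin: "finite x" "finite y" using finite_in_Omega x y by blast+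
  have sub: "fvec.subspace x" "fvec.subspace y" using OmegaD x y by blast+
  have "card (?fib w) \<le> card (x \<inter> y)" for w
  proof (cases "?fib w = {}")
    case True
    then show ?thesis by (simp only: card.empty)
  next
    case False
    then obtain u0 v0 where p: "u0 \<in> x" "v0 \<in> y" "u0 + v0 = w" by auto
    show ?thesis
    proof (rule card_inj_on_le[of "\<lambda>(u, v). u - u0"])
      show "inj_on (\<lambda>(u, v). u - u0) (?fib w)" by (auto simp: inj_on_def)
      show "(\<lambda>(u, v). u - u0) ` ?fib w \<subseteq> x \<inter> y"
      proof (intro subsetI)
        fix d assume "d \<in> (\<lambda>(u, v). u - u0) ` ?fib w"
        then obtain u v where uv: "u \<in> x" "v \<in> y" "u + v = w" "d = u - u0" by auto
        have "u - u0 = (u + v) - v - u0" by simp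
        also have "\<dots> = v0 - v" unfolding uv(3) p(3)[symmetric] by simp
        finally have "d = v0 - v" using uv(4) by simp
        then show "d \<in> x \<inter> y"
          using fvec.subspace_diff[OF sub(1) uv(1) p(1)] fvec.subspace_diff[OF sub(2) p(2) uv(2)] uv(4) by simp
      qed
    qed (use fin in auto)
  qed
  then have "(\<Sum>w\<in>Fn n. card (?fib w)) \<le> (\<Sum>w\<in>(Fn n :: (nat \<Rightarrow> 'a) set). card (x \<inter> y))" by (rule sum_mono)
  moreover have "(\<Sum>w\<in>Fn n. card (?fib w)) = card (x \<times> y)"
  proof -
    have "(\<Sum>w\<in>Fn n. \<Sum>p\<in>?fib w. 1) = (\<Sum>p\<in>x \<times> y. 1 :: nat)"
      using OmegaD(2)[OF x] OmegaD(2)[OF y] fin by (intro sum.group finite_Fn) (auto intro!: Fn_add)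
    then show ?thesis by simp
  qed
  ultimately show ?thesis by (simp add: card_cartesian_product card_Fn)
qed

lemma t_intersecting_large_dim:
  "t_intersecting t {x :: (nat \<Rightarrow> 'a::{field,finite}) set. x \<in> Omega n \<and> n + t \<le> 2 * fvec.dim x}"
  unfolding t_intersecting_def
proof (intro ballI)
  fix x y :: "(nat \<Rightarrow> 'a) set"
  assume xy: "x \<in> {x. x \<in> Omega n \<and> n + t \<le> 2 * fvec.dim x}" "y \<in> {x. x \<in> Omega n \<and> n + t \<le> 2 * fvec.dim x}"
  then have O: "x \<in> Omega n" "y \<in> Omega n" by auto
  have "CARD('a) ^ (fvec.dim x + fvec.dim y) \<le> CARD('a) ^ (n + fvec.dim (x \<inter> y))"
    using card_mult_le_card_Int[OF O] card_in_Omega[OF O(1)] card_in_Omega[OF O(2)] card_in_Omega[OF Omega_Int[OF O]]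
    by (simp add: power_add)
  then have "fvec.dim x + fvec.dim y \<le> n + fvec.dim (x \<inter> y)"
    using CARD_field_ge_2[where 'a='a] by (subst (asm) power_increasing_iff) auto
  then show "t \<le> fvec.dim (x \<inter> y)" using xy by auto
qed

text \<open>For \<open>z = 1/q\<close> the shift of the index goes down by one, and the quotient of products is
\<open>(1 + \<sigma>/q) / (1 + \<sigma> q^(n - 1))\<close>.\<close>

lemma negative_moment_phi_le:
  assumes \<sigma>: "0 < \<sigma>" "\<sigma> \<le> 1" and n: "0 < n"
  shows "(\<Sum>x\<in>Omega n. (1 / real CARD('a)) ^ fvec.dim (x :: (nat \<Rightarrow> 'a::{field,finite}) set) * phi CARD('a) \<sigma> n (fvec.dim x))
    \<le> 2 * real CARD('a) / (\<sigma> * real CARD('a) ^ n)"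
proof -
  let ?q = "real CARD('a)" and ?f = "\<lambda>j. 1 + \<sigma> * real CARD('a) ^ j"
  obtain m where m: "n = Suc m" using n by (cases n) auto
  have q1: "1 \<le> ?q" using CARD_field_ge_2[where 'a='a] by simp
  have "(\<Prod>j<n. 1 + 1 / ?q * \<sigma> * ?q ^ j) = (1 + \<sigma> / ?q) * prod ?f {..<m}"
    unfolding m prod.lessThan_Suc_shift using q1 by simp
  moreover have "prod ?f {..<n} = prod ?f {..<m} * ?f m" by (simp add: m)
  ultimately have "(\<Sum>x\<in>Omega n. (1 / ?q) ^ fvec.dim (x :: (nat \<Rightarrow> 'a) set) * phi CARD('a) \<sigma> n (fvec.dim x))
      = (1 + \<sigma> / ?q) / ?f m"
    using sum_power_phi[OF \<sigma>(1), of "1 / ?q" n, where 'a='a] \<sigma>(1) by (simp add: one_plus_ne_0)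
  also have "\<dots> \<le> 2 / (\<sigma> * ?q ^ m)"
  proof (rule frac_le)
    have "\<sigma> / ?q \<le> 1 / 1" using \<sigma> q1 by (intro frac_le) auto
    then show "1 + \<sigma> / ?q \<le> 2" by simp
  qed (use \<sigma> in auto)
  also have "\<dots> = 2 * ?q / (\<sigma> * ?q ^ n)" using q1 by (simp add: m)
  finally show ?thesis .
qed

text \<open>Markov's inequality applied to \<open>q ^ (- dim x)\<close> bounds the measure of the complement.\<close>

lemma mu_large_dim_ge:
  assumes \<sigma>: "0 < \<sigma>" "\<sigma> \<le> 1" and n: "0 < n"
  shows "1 - real CARD('a) powr ((real n + real t) / 2) * (2 * real CARD('a) / (\<sigma> * real CARD('a) ^ n))
    \<le> mu \<sigma> n {x :: (nat \<Rightarrow> 'a::{field,finite}) set. x \<in> Omega n \<and> n + t \<le> 2 * fvec.dim x}"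
proof -
  let ?q = "real CARD('a)" and ?\<phi> = "phi CARD('a) \<sigma> n" and ?c = "real CARD('a) powr ((real n + real t) / 2)"
  let ?U = "{x :: (nat \<Rightarrow> 'a) set. x \<in> Omega n \<and> n + t \<le> 2 * fvec.dim x}"
  let ?B = "{x :: (nat \<Rightarrow> 'a) set. x \<in> Omega n \<and> \<not> n + t \<le> 2 * fvec.dim x}"
  have q1: "1 \<le> ?q" "0 < ?q" using CARD_field_ge_2[where 'a='a] by simp_all
  have fin: "finite ?U" "finite ?B" by (rule finite_subset[OF _ finite_Omega[of n]], blast)+
  have "?U \<union> ?B = Omega n" "?U \<inter> ?B = {}" by auto
  then have "mu \<sigma> n ?U + mu \<sigma> n ?B = 1"
    using mu_Omega[OF \<sigma>(1), of n, where 'a='a] sum.union_disjoint[OF fin, of "\<lambda>x. ?\<phi> (fvec.dim x)"] by (simp add: mu_def)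
  moreover have "mu \<sigma> n ?B \<le> (\<Sum>x\<in>?B. ?c * ((1 / ?q) ^ fvec.dim x * ?\<phi> (fvec.dim x)))"
    unfolding mu_def
  proof (rule sum_mono)
    fix x assume "x \<in> ?B"
    then have "real (fvec.dim x) \<le> (real n + real t) / 2" by auto
    then have "1 \<le> ?q powr ((real n + real t) / 2 - real (fvec.dim x))"
      using q1 by (intro ge_one_powr_ge_zero) auto
    also have "\<dots> = ?c * (1 / ?q) ^ fvec.dim x"
      using q1 by (simp add: powr_diff powr_realpow power_one_over)
    finally have "1 * ?\<phi> (fvec.dim x) \<le> ?c * (1 / ?q) ^ fvec.dim x * ?\<phi> (fvec.dim x)"
      using phi_nonneg[OF \<sigma>(1)] by (rule mult_right_mono)
    then show "?\<phi> (fvec.dim x) \<le> ?c * ((1 / ?q) ^ fvec.dim x * ?\<phi> (fvec.dim x))" by (simp add: mult.assoc)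
  qed
  moreover have "\<dots> \<le> (\<Sum>x\<in>Omega n. ?c * ((1 / ?q) ^ fvec.dim (x :: (nat \<Rightarrow> 'a) set) * ?\<phi> (fvec.dim x)))"
    using phi_nonneg[OF \<sigma>(1)] by (intro sum_mono2 finite_Omega mult_nonneg_nonneg) auto
  moreover have "\<dots> \<le> ?c * (2 * ?q / (\<sigma> * ?q ^ n))"
    unfolding sum_distrib_left[symmetric] using negative_moment_phi_le[OF assms, where 'a='a]
    by (rule mult_left_mono) simp
  ultimately show ?thesis by linarith
qed

section \<open>The limit\<close>

lemma fmax_le:
  assumes "\<And>U :: (nat \<Rightarrow> 'a::{field,finite}) set set. U \<subseteq> Omega n \<Longrightarrow> t_intersecting t U \<Longrightarrow> mu \<sigma> n U powr (1 / real n) \<le> B"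
  shows "fmax TYPE('a) n t \<sigma> \<le> B"
  unfolding fmax_def using assms by (subst Max_le_iff[OF fmax_set]) auto

lemma fmax_ge:
  assumes "(U :: (nat \<Rightarrow> 'a::{field,finite}) set set) \<subseteq> Omega n" "t_intersecting t U"
    "0 \<le> B" "B \<le> mu \<sigma> n U"
  shows "B powr (1 / real n) \<le> fmax TYPE('a) n t \<sigma>"
proof -
  have "mu \<sigma> n U powr (1 / real n) \<le> fmax TYPE('a) n t \<sigma>"
    unfolding fmax_def using assms by (intro Max_ge fmax_set) auto
  moreover have "B powr (1 / real n) \<le> mu \<sigma> n U powr (1 / real n)"
    using assms by (intro powr_mono2) auto
  ultimately show ?thesis by linarith
qed

lemma root_const_tendsto_1: "0 < C \<Longrightarrow> (\<lambda>n. C powr (1 / real n)) \<longlonglongrightarrow> 1" for C :: real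
  using tendsto_powr[OF tendsto_const[of C] lim_1_over_n] by simp

lemma root_mult_power:
  assumes "0 \<le> C" "0 \<le> r" "0 < n"
  shows "(C * r ^ n) powr (1 / real n) = C powr (1 / real n) * (r :: real)"
  using assms by (cases "r = 0") (simp_all add: powr_mult powr_powr flip: powr_realpow)

lemma sigma_theta_bounds:
  assumes "1 \<le> q" "\<theta> < 1"
  shows "0 < sigma_theta q \<theta> n" "sigma_theta q \<theta> n \<le> 1"
proof -
  show "0 < sigma_theta q \<theta> n" using assms by (simp add: sigma_theta_def)
  have "real q powr (- (1 - \<theta>) * real n) \<le> real q powr 0"
    using assms by (intro powr_mono) (auto simp: mult_nonpos_nonneg)
  then show "sigma_theta q \<theta> n \<le> 1" using assms by (simp add: sigma_theta_def)
qed

lemma fmax_limit_small: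
  assumes pp: "primepow CARD('a::{field,finite})" and \<theta>: "0 < \<theta>" "\<theta> < 1/2"
  shows "(\<lambda>n. fmax TYPE('a) n t (sigma_theta CARD('a) \<theta> n)) \<longlonglongrightarrow> real CARD('a) powr (- (1 - \<theta>) * real t)"
proof -
  let ?q = "real CARD('a)" and ?r = "real CARD('a) powr (- (1 - \<theta>) * real t)"
  have q1: "1 \<le> CARD('a)" using CARD_field_ge_2[where 'a='a] by simp
  have \<sigma>: "0 < sigma_theta CARD('a) \<theta> n" "sigma_theta CARD('a) \<theta> n \<le> 1" for n
    using sigma_theta_bounds[OF q1, of \<theta> n] \<theta> by simp_all
  obtain s where "real t * (1 - \<theta>) / (1 / 2 - \<theta>) \<le> real s" using real_arch_simple by blast
  then have s: "real t * (1 - \<theta>) \<le> real s * (1 / 2 - \<theta>)" using \<theta> by (simp add: field_simps)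
  define C where "C = (2 * ?q ^ t) ^ t + (2 * ?q ^ s) ^ s"
  define c where "c = 1 / (2 * ?q ^ t) ^ t"
  have C0: "0 < C" "0 < c" using q1 by (simp_all add: C_def c_def add_pos_pos)
  have upper: "fmax TYPE('a) n t (sigma_theta CARD('a) \<theta> n) \<le> C powr (1 / real n) * ?r" if n: "0 < n" for n
  proof (rule fmax_le)
    fix U :: "(nat \<Rightarrow> 'a) set set" assume U: "U \<subseteq> Omega n" "t_intersecting t U"
    have "mu (sigma_theta CARD('a) \<theta> n) n U powr (1 / real n) \<le> (C * ?r ^ n) powr (1 / real n)"
      unfolding C_def using mu_t_intersecting_le[OF pp n \<theta>(1) s U] mu_nonneg[OF \<sigma>(1)]
      by (intro powr_mono2) auto
    then show "mu (sigma_theta CARD('a) \<theta> n) n U powr (1 / real n) \<le> C powr (1 / real n) * ?r"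
      using C0 n by (subst (asm) root_mult_power) auto
  qed
  have lower: "c powr (1 / real n) * ?r \<le> fmax TYPE('a) n t (sigma_theta CARD('a) \<theta> n)" if n: "0 < n" "t \<le> n" for n
  proof -
    let ?\<sigma> = "sigma_theta CARD('a) \<theta> n"
    have "?\<sigma> ^ t = ?r ^ n"
      using q1 by (simp add: sigma_theta_def powr_powr mult_ac flip: powr_realpow)
    then have "c * ?r ^ n \<le> mu ?\<sigma> n {x. x \<in> Omega n \<and> (Fn t :: (nat \<Rightarrow> 'a) set) \<subseteq> x}"
      using mu_over_Fn_ge[OF n(2) \<sigma>[of n], where 'a='a] by (simp add: c_def)
    then have "(c * ?r ^ n) powr (1 / real n) \<le> fmax TYPE('a) n t ?\<sigma>"
      using C0 by (intro fmax_ge[OF _ t_intersecting_over_Fn]) auto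
    then show ?thesis using C0 n by (subst (asm) root_mult_power) auto
  qed
  have lim: "(\<lambda>n. D powr (1 / real n) * ?r) \<longlonglongrightarrow> ?r" if "0 < D" for D
    using tendsto_mult_right[OF root_const_tendsto_1[OF that], of ?r] by simp
  show ?thesis
  proof (rule tendsto_sandwich[OF _ _ lim[OF C0(2)] lim[OF C0(1)]])
    show "\<forall>\<^sub>F n in sequentially. c powr (1 / real n) * ?r \<le> fmax TYPE('a) n t (sigma_theta CARD('a) \<theta> n)"
      using eventually_gt_at_top[of 0] eventually_ge_at_top[of t] by eventually_elim (rule lower)
    show "\<forall>\<^sub>F n in sequentially. fmax TYPE('a) n t (sigma_theta CARD('a) \<theta> n) \<le> C powr (1 / real n) * ?r"
      using eventually_gt_at_top[of 0] by eventually_elim (rule upper)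
  qed
qed

lemma fmax_limit_large:
  assumes \<theta>: "1/2 < \<theta>" "\<theta> < 1"
  shows "(\<lambda>n. fmax TYPE('a::{field,finite}) n t (sigma_theta CARD('a) \<theta> n)) \<longlonglongrightarrow> 1"
proof -
  let ?q = "real CARD('a)"
  have q2: "2 \<le> CARD('a)" by (rule CARD_field_ge_2)
  then have q1: "1 \<le> CARD('a)" by simp
  let ?e = "\<lambda>n. ?q powr ((real n + real t) / 2) * (2 * ?q / (sigma_theta CARD('a) \<theta> n * ?q ^ n))"
  have e: "?e n = ?q powr (real t / 2) * 2 * ?q * (?q powr (1 / 2 - \<theta>)) ^ n" for n
  proof -
    have "sigma_theta CARD('a) \<theta> n * ?q ^ n = ?q powr (\<theta> * real n)"
      using q1 by (simp add: sigma_theta_def powr_realpow[symmetric] powr_add[symmetric] algebra_simps)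
    moreover have "(?q powr (1 / 2 - \<theta>)) ^ n = ?q powr (real n / 2) / ?q powr (\<theta> * real n)"
      using q1 by (simp add: powr_realpow[symmetric] powr_powr powr_diff[symmetric] algebra_simps)
    ultimately show ?thesis by (simp add: add_divide_distrib powr_add)
  qed
  have "?q powr (1 / 2 - \<theta>) < ?q powr 0" using q2 \<theta> by (intro powr_less_mono) auto
  then have "(\<lambda>n. (?q powr (1 / 2 - \<theta>)) ^ n) \<longlonglongrightarrow> 0" using q1 by (intro LIMSEQ_realpow_zero) auto
  then have e0: "?e \<longlonglongrightarrow> 0" unfolding e by (rule tendsto_mult_right_zero)
  \<comment> \<open>A measure of at least \<open>1/2\<close> is enough, since the \<open>n\<close>-th root of a constant tends to \<open>1\<close>.\<close>
  have ev: "\<forall>\<^sub>F n in sequentially. ?e n < 1/2" by (rule order_tendstoD(2)[OF e0]) simp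
  show ?thesis
  proof (rule tendsto_sandwich[OF _ _ root_const_tendsto_1[of "1/2"] tendsto_const])
    show "\<forall>\<^sub>F n in sequentially. (1/2) powr (1 / real n) \<le> fmax TYPE('a) n t (sigma_theta CARD('a) \<theta> n)"
      using ev eventually_gt_at_top[of 0]
    proof eventually_elim
      case (elim n)
      then have "1/2 \<le> mu (sigma_theta CARD('a) \<theta> n) n {x :: (nat \<Rightarrow> 'a) set. x \<in> Omega n \<and> n + t \<le> 2 * fvec.dim x}"
        using mu_large_dim_ge[OF sigma_theta_bounds[OF q1 \<theta>(2), of n] elim(2), of t, where 'a='a] by linarith
      then show ?case by (intro fmax_ge[OF _ t_intersecting_large_dim]) auto
    qed
    show "\<forall>\<^sub>F n in sequentially. fmax TYPE('a) n t (sigma_theta CARD('a) \<theta> n) \<le> 1"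
    proof (intro always_eventually allI fmax_le powr_le1)
      fix n and U :: "(nat \<Rightarrow> 'a) set set" assume U: "U \<subseteq> Omega n"
      have \<sigma>: "0 < sigma_theta CARD('a) \<theta> n" using sigma_theta_bounds(1)[OF q1 \<theta>(2)] .
      show "\<bar>mu (sigma_theta CARD('a) \<theta> n) n U\<bar> \<le> 1"
        using mu_nonneg[OF \<sigma>, of n U] mu_le_1[OF \<sigma> U] by simp
    qed simp
  qed simp
qed

theorem theorem2:
  fixes q t :: nat and \<theta> :: real
  assumes "primepow q"
    and "CARD('a::{field,finite}) = q"
    and "t \<ge> 1"
  shows "(0 < \<theta> \<and> \<theta> < 1/2 \<longrightarrow>
            (\<lambda>n. fmax TYPE('a) n t (sigma_theta q \<theta> n)) \<longlonglongrightarrow> real q powr (- (1 - \<theta>) * real t))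
       \<and> (1/2 < \<theta> \<and> \<theta> < 1 \<longrightarrow>
            (\<lambda>n. fmax TYPE('a) n t (sigma_theta q \<theta> n)) \<longlonglongrightarrow> 1)"
  using fmax_limit_small[where 'a='a, of \<theta> t] fmax_limit_large[where 'a='a, of \<theta> t] assms by auto

end
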